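(* Let $\mathcal{P}$ be a persistent clique partition of a metric space $(X,d)$. The persistence module of the Vietoris–Rips complexes of the quotient space is $3$-approximated with that of the standard Vietoris–Rips filtration: $H_*\mathrm{CoNrv}(\mathcal{M})$ and $H_*\mathrm{CoNrv}(\mathcal{M}_Q)$ are $3$-approximated, where $\mathcal{M}(r)$ is the maximal-clique cover of $(X,d)$ and $\mathcal{M}_Q(r)$ is the maximal-clique cover of $(X/\mathcal{P}(r),d_{\mathcal{P}(r)})$ at scale $r$.
   Context: $\mathbb{R}_+=[0,\infty)$. For a set $Y$ with a symmetric dissimilarity $\delta\ge0$ vanishing on the diagonal (the triangle inequality is not required), a subset $M\subseteq Y$ is an $r$-clique if $\delta(x,y)\le r$ for all $x,y\in M$, and is maximal if not properly contained in another $r$-clique; the maximal-clique cover at scale $r$ is the cover of $Y$ by all maximal $r$-cliques. A persistent clique partition $\mathcal{P}$ of $X$ assigns to each $r\in\mathbb{R}_+$ a partition $\mathcal{P}(r)$ of $X$ (into nonempty blocks) such that every block $C\in\mathcal{P}(r)$ has $\mathrm{diam}(C)\le r$, and for $s\le t$ every block of $\mathcal{P}(s)$ is contained in a block of $\mathcal{P}(t)$. $X/\mathcal{P}(r)$ is the set of blocks, with dissimilarity $d_{\mathcal{P}(r)}(C_i,C_j)=\min_{x\in C_i,\,y\in C_j}d(x,y)$ (read as an infimum if not attained). For $r\le s$ let $\pi_{r,s}:X/\mathcal{P}(r)\to X/\mathcal{P}(s)$ send a block to the block containing it. The co-nerve of a cover $\mathcal{U}=\{U_i\}_{i\in I}$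 of a set $Y$ is the simplicial complex $\mathrm{CoNrv}(\mathcal{U})$ whose simplices are the finite nonempty $\sigma\subseteq Y$ with $\sigma\subseteq U_i$ for some $i$; for the maximal-clique cover at scale $r$ this is the Vietoris–Rips complex at scale $r$. $H_*$ is simplicial homology with coefficients in a fixed field. Structure maps of $H_*\mathrm{CoNrv}(\mathcal{M})$ are induced by inclusions, and those of $H_*\mathrm{CoNrv}(\mathcal{M}_Q)$ by the simplicial maps given on vertices by $\pi_{r,s}$. A persistence module is a functor from $(\mathbb{R}_+,\le)$ to vector spaces. Persistence modules $F,G$ are $c$-approximated ($c\ge1$) if there are natural transformations $\phi:F\Rightarrow G\circ S_c$ and $\psi:G\Rightarrow F\circ S_c$, with $S_c(r)=cr$, such that $\psi_{cr}\circ\phi_r=F(r\le c^2r)$ and $\phi_{cr}\circ\psi_r=G(r\le c^2r)$ for all $r$. *)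

theory Defs
  imports
    "HOL-Analysis.Analysis"
    "HOL-Combinatorics.Permutations"
    "HOL-Algebra.AbelCoset"
    "Jordan_Normal_Form.VS_Connect"
begin

section \<open>Maximal-clique covers and co-nerves\<close>

definition clique :: "'a set \<Rightarrow> ('a \<Rightarrow> 'a \<Rightarrow> real) \<Rightarrow> real \<Rightarrow> 'a set \<Rightarrow> bool" where
  "clique Y \<delta> r M \<longleftrightarrow> M \<subseteq> Y \<and> (\<forall>x\<in>M. \<forall>y\<in>M. \<delta> x y \<le> r)"

definition maximal_clique :: "'a set \<Rightarrow> ('a \<Rightarrow> 'a \<Rightarrow> real) \<Rightarrow> real \<Rightarrow> 'a set \<Rightarrow> bool" where
  "maximal_clique Y \<delta> r M \<longleftrightarrow> clique Y \<delta> r M \<and> (\<nexists>N. clique Y \<delta> r N \<and> M \<subset> N)"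

definition maximal_clique_cover :: "'a set \<Rightarrow> ('a \<Rightarrow> 'a \<Rightarrow> real) \<Rightarrow> real \<Rightarrow> 'a set set" where
  "maximal_clique_cover Y \<delta> r = {M. maximal_clique Y \<delta> r M}"

definition co_nerve :: "'a set \<Rightarrow> 'a set set \<Rightarrow> 'a set set" where
  "co_nerve Y \<U> = {\<sigma>. finite \<sigma> \<and> \<sigma> \<noteq> {} \<and> \<sigma> \<subseteq> Y \<and> (\<exists>U\<in>\<U>. \<sigma> \<subseteq> U)}"


section \<open>Persistent clique partitions\<close>

text \<open>The diameter is taken in the extended reals, so that unbounded sets have diameter \<open>\<infinity>\<close>.\<close>

definition ediameter :: "('a \<Rightarrow> 'a \<Rightarrow> real) \<Rightarrow> 'a set \<Rightarrow> ereal" where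
  "ediameter d C = (SUP (x, y)\<in>C \<times> C. ereal (d x y))"

definition persistent_clique_partition ::
    "'a set \<Rightarrow> ('a \<Rightarrow> 'a \<Rightarrow> real) \<Rightarrow> (real \<Rightarrow> 'a set set) \<Rightarrow> bool" where
  "persistent_clique_partition X d P \<longleftrightarrow>
     (\<forall>r\<ge>0. partition_on X (P r) \<and> (\<forall>C\<in>P r. ediameter d C \<le> ereal r)) \<and>
     (\<forall>s t. 0 \<le> s \<and> s \<le> t \<longrightarrow> (\<forall>C\<in>P s. \<exists>D\<in>P t. C \<subseteq> D))"

definition block_dist :: "('a \<Rightarrow> 'a \<Rightarrow> real) \<Rightarrow> 'a set \<Rightarrow> 'a set \<Rightarrow> real" where
  "block_dist d C D = (INF (x, y)\<in>C \<times> D. d x y)"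

definition block_map :: "(real \<Rightarrow> 'a set set) \<Rightarrow> real \<Rightarrow> real \<Rightarrow> 'a set \<Rightarrow> 'a set" where
  "block_map P r s C = (THE D. D \<in> P s \<and> C \<subseteq> D)"


section \<open>Simplicial homology with coefficients in a field\<close>

text \<open>
  A simplicial complex is given by its set of simplices.  Its \<open>n\<close>-chains are oriented chains:
  a chain assigns a coefficient to every ordered \<open>n\<close>-simplex, given as the list of its \<open>n + 1\<close>
  distinct vertices, only finitely many coefficients are nonzero, and reordering the vertices
  multiplies the coefficient by the sign of the permutation.
\<close>

definition chains :: "'a set set \<Rightarrow> nat \<Rightarrow> ('a list \<Rightarrow> 'k::field) set" where
  "chains S n = {c. finite {xs. c xs \<noteq> 0} \<and>
     (\<forall>xs. c xs \<noteq> 0 \<longrightarrow> length xs = Suc n \<and> distinct xs \<and> set xs \<in> S) \<and>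
     (\<forall>xs p. p permutes {..<length xs} \<longrightarrow> c (permute_list p xs) = of_int (sign p) * c xs)}"

text \<open>
  The oriented simplex \<open>[x\<^sub>0, \<dots>, x\<^sub>n]\<close> as a chain: it is alternating in the \<open>x\<^sub>i\<close>, and zero if two
  of them coincide.
\<close>

definition oriented_simplex :: "'a list \<Rightarrow> 'a list \<Rightarrow> 'k::field" where
  "oriented_simplex xs = (\<lambda>ys. if distinct xs then
     (\<Sum>p | p permutes {..<length xs} \<and> permute_list p xs = ys. of_int (sign p)) else 0)"

text \<open>
  The coefficient of \<open>\<partial>c\<close> at \<open>w\<close>: the simplices with face \<open>w\<close> are \<open>w \<union> {v}\<close>, and oriented as
  \<open>v # w\<close> such a simplex contributes \<open>w\<close> with sign \<open>+1\<close> to its boundary.  The boundary of a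
  \<open>0\<close>-chain is zero (homology is not reduced).  Lemma \<open>boundary_oriented_simplex\<close> below is
  the usual formula on generators.
\<close>

definition boundary :: "('a list \<Rightarrow> 'k::field) \<Rightarrow> 'a list \<Rightarrow> 'k" where
  "boundary c = (\<lambda>w. if w = [] then 0 else (\<Sum>v | c (v # w) \<noteq> 0. c (v # w)))"

text \<open>
  The chain map of a simplicial map \<open>f\<close>; by lemma \<open>push_oriented_simplex\<close> below it sends
  \<open>[x\<^sub>0, \<dots>, x\<^sub>n]\<close> to \<open>[f x\<^sub>0, \<dots>, f x\<^sub>n]\<close>, which is zero if \<open>f\<close> identifies two vertices.
\<close>

definition push :: "('a \<Rightarrow> 'b) \<Rightarrow> ('a list \<Rightarrow> 'k::field) \<Rightarrow> 'b list \<Rightarrow> 'k" where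
  "push f c = (\<lambda>w. if distinct w then (\<Sum>xs | map f xs = w \<and> c xs \<noteq> 0. c xs) else 0)"

definition cycles :: "'a set set \<Rightarrow> nat \<Rightarrow> ('a list \<Rightarrow> 'k::field) set" where
  "cycles S n = {c \<in> chains S n. boundary c = (\<lambda>_. 0)}"

definition boundaries :: "'a set set \<Rightarrow> nat \<Rightarrow> ('a list \<Rightarrow> 'k::field) set" where
  "boundaries S n = boundary ` chains S (Suc n)"

text \<open>
  The fields \<open>mult\<close> and \<open>one\<close> of the records below are not used by modules.
\<close>

definition function_space :: "('b \<Rightarrow> 'k::field) set \<Rightarrow> ('k, 'b \<Rightarrow> 'k) module" where
  "function_space A = \<lparr>carrier = A, mult = undefined, one = undefined,
     zero = (\<lambda>_. 0), add = (\<lambda>f g x. f x + g x), smult = (\<lambda>a f x. a * f x)\<rparr>"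

definition quotient_space :: "('k, 'v) module \<Rightarrow> 'v set \<Rightarrow> ('k, 'v set) module" where
  "quotient_space V W = \<lparr>carrier = a_rcosets\<^bsub>V\<^esub> W, mult = undefined, one = undefined,
     zero = W, add = set_add V, smult = (\<lambda>a C. W <+>\<^bsub>V\<^esub> ((\<lambda>x. a \<odot>\<^bsub>V\<^esub> x) ` C))\<rparr>"

definition homology :: "nat \<Rightarrow> 'a set set \<Rightarrow> ('k::field, ('a list \<Rightarrow> 'k) set) module" where
  "homology n S = quotient_space (function_space (cycles S n)) (boundaries S n)"

text \<open>
  The map on \<open>n\<close>-th homology induced by a simplicial map \<open>f\<close> into the complex \<open>T\<close>,
  \<open>[c] \<mapsto> [push f c]\<close>.
\<close>

definition homology_map ::
    "nat \<Rightarrow> 'b set set \<Rightarrow> ('a \<Rightarrow> 'b) \<Rightarrow> ('a list \<Rightarrow> 'k::field) set \<Rightarrow> ('b list \<Rightarrow> 'k) set" where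
  "homology_map n T f C = boundaries T n <+>\<^bsub>function_space (cycles T n)\<^esub> (push f ` C)"


section \<open>Persistence modules\<close>

record ('k, 'v) persistence_module =
  space_at :: "real \<Rightarrow> ('k, 'v) module"
  map_at :: "real \<Rightarrow> real \<Rightarrow> 'v \<Rightarrow> 'v"

text \<open>Indices range over \<open>[0, \<infinity>)\<close>; values at negative reals are irrelevant throughout.\<close>

definition is_persistence_module ::
    "('k, 'm) ring_scheme \<Rightarrow> ('k, 'v) persistence_module \<Rightarrow> bool" where
  "is_persistence_module K F \<longleftrightarrow>
     (\<forall>r\<ge>0. vectorspace K (space_at F r)) \<and>
     (\<forall>r s. 0 \<le> r \<and> r \<le> s \<longrightarrow> linear_map K (space_at F r) (space_at F s) (map_at F r s)) \<and>
     (\<forall>r\<ge>0. \<forall>x\<in>carrier (space_at F r). map_at F r r x = x) \<and>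
     (\<forall>r s t. 0 \<le> r \<and> r \<le> s \<and> s \<le> t \<longrightarrow>
        (\<forall>x\<in>carrier (space_at F r). map_at F s t (map_at F r s x) = map_at F r t x))"

definition natural_transformation ::
    "('k, 'm) ring_scheme \<Rightarrow> ('k, 'v) persistence_module \<Rightarrow> ('k, 'w) persistence_module \<Rightarrow>
     (real \<Rightarrow> 'v \<Rightarrow> 'w) \<Rightarrow> bool" where
  "natural_transformation K F G \<phi> \<longleftrightarrow>
     (\<forall>r\<ge>0. linear_map K (space_at F r) (space_at G r) (\<phi> r)) \<and>
     (\<forall>r s. 0 \<le> r \<and> r \<le> s \<longrightarrow>
        (\<forall>x\<in>carrier (space_at F r). \<phi> s (map_at F r s x) = map_at G r s (\<phi> r x)))"

definition rescale :: "real \<Rightarrow> ('k, 'v) persistence_module \<Rightarrow> ('k, 'v) persistence_module" where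
  "rescale c F = \<lparr>space_at = (\<lambda>r. space_at F (c * r)),
                  map_at = (\<lambda>r s. map_at F (c * r) (c * s))\<rparr>"

definition approximated ::
    "('k, 'm) ring_scheme \<Rightarrow> real \<Rightarrow> ('k, 'v) persistence_module \<Rightarrow>
     ('k, 'w) persistence_module \<Rightarrow> bool" where
  "approximated K c F G \<longleftrightarrow>
     c \<ge> 1 \<and> is_persistence_module K F \<and> is_persistence_module K G \<and>
     (\<exists>\<phi> \<psi>. natural_transformation K F (rescale c G) \<phi> \<and>
            natural_transformation K G (rescale c F) \<psi> \<and>
            (\<forall>r\<ge>0. \<forall>x\<in>carrier (space_at F r). \<psi> (c * r) (\<phi> r x) = map_at F r (c\<^sup>2 * r) x) \<and>
            (\<forall>r\<ge>0. \<forall>y\<in>carrier (space_at G r). \<phi> (c * r) (\<psi> r y) = map_at G r (c\<^sup>2 * r) y))"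

text \<open>
  \<open>H\<^sub>n\<close> of a family of complexes \<open>S r\<close> with simplicial maps \<open>f r s\<close> from \<open>S r\<close> to \<open>S s\<close>.
\<close>

definition persistent_homology ::
    "nat \<Rightarrow> (real \<Rightarrow> 'a set set) \<Rightarrow> (real \<Rightarrow> real \<Rightarrow> 'a \<Rightarrow> 'a) \<Rightarrow>
     ('k::field, ('a list \<Rightarrow> 'k) set) persistence_module" where
  "persistent_homology n S f = \<lparr>space_at = (\<lambda>r. homology n (S r)),
                                map_at = (\<lambda>r s. homology_map n (S s) (f r s))\<rparr>"

definition clique_homology ::
    "nat \<Rightarrow> 'a set \<Rightarrow> ('a \<Rightarrow> 'a \<Rightarrow> real) \<Rightarrow> ('k::field, ('a list \<Rightarrow> 'k) set) persistence_module" where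
  "clique_homology n X d =
     persistent_homology n (\<lambda>r. co_nerve X (maximal_clique_cover X d r)) (\<lambda>r s x. x)"

definition quotient_clique_homology ::
    "nat \<Rightarrow> ('a \<Rightarrow> 'a \<Rightarrow> real) \<Rightarrow> (real \<Rightarrow> 'a set set) \<Rightarrow>
     ('k::field, ('a set list \<Rightarrow> 'k) set) persistence_module" where
  "quotient_clique_homology n d P =
     persistent_homology n
       (\<lambda>r. co_nerve (P r) (maximal_clique_cover (P r) (block_dist d) r)) (block_map P)"


section \<open>Boundary and induced chain maps on generators\<close>

lemma oriented_simplex_permute_list:
  assumes "distinct xs" "p permutes {..<length xs}"
  shows "oriented_simplex xs (permute_list p xs) = (of_int (sign p) :: 'k::field)"
proof -
  have "q = p" if q: "q permutes {..<length xs}" "permute_list q xs = permute_list p xs" for q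
  proof
    fix i
    show "q i = p i"
    proof (cases "i < length xs")
      case True
      then have "xs ! q i = xs ! p i"
        using q assms(2) by (metis permute_list_nth)
      then show ?thesis
        using True q(1) assms permutes_in_image[OF q(1), of i] permutes_in_image[OF assms(2), of i]
        by (simp add: nth_eq_iff_index_eq)
    next
      case False
      then show ?thesis
        using q(1) assms(2) by (simp add: permutes_not_in)
    qed
  qed
  then have "{q. q permutes {..<length xs} \<and> permute_list q xs = permute_list p xs} = {p}"
    using assms(2) by auto
  then show ?thesis
    using assms(1) by (simp add: oriented_simplex_def)
qed

lemma oriented_simplex_nonzeroD:
  assumes "oriented_simplex xs ys \<noteq> (0 :: 'k::field)"
  shows "distinct xs" "\<exists>p. p permutes {..<length xs} \<and> ys = permute_list p xs"
proof -
  show "distinct xs"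
    using assms by (auto simp: oriented_simplex_def split: if_splits)
  have "{p. p permutes {..<length xs} \<and> permute_list p xs = ys} \<noteq> {}"
  proof
    assume "{p. p permutes {..<length xs} \<and> permute_list p xs = ys} = {}"
    then have "oriented_simplex xs ys = (0 :: 'k)"
      by (simp only: oriented_simplex_def sum.empty if_cancel)
    with assms show False ..
  qed
  then show "\<exists>p. p permutes {..<length xs} \<and> ys = permute_list p xs"
    by auto
qed

lemma oriented_simplex_eq_0:
  assumes "mset ys \<noteq> mset xs \<or> \<not> distinct xs"
  shows "oriented_simplex xs ys = (0 :: 'k::field)"
  using oriented_simplex_nonzeroD[of xs ys, where ?'k = 'k] assms by (metis mset_permute_list)

lemma sign_compose_permutes:
  assumes "p permutes {..<n}" "q permutes {..<n::nat}"
  shows "sign (p \<circ> q) = sign p * sign q"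
  using assms by (metis finite_lessThan permutation_permutes sign_compose)

lemma oriented_simplex_alternating:
  assumes "p permutes {..<length ys}"
  shows "oriented_simplex xs (permute_list p ys) = (of_int (sign p) * oriented_simplex xs ys :: 'k::field)"
proof (cases "mset ys = mset xs \<and> distinct xs")
  case True
  then obtain q where q: "q permutes {..<length xs}" "permute_list q xs = ys"
    by (metis mset_eq_permutation)
  have p: "p permutes {..<length xs}"
    using assms q(2) by auto
  have "permute_list p ys = permute_list (q \<circ> p) xs"
    using permute_list_compose[OF p, of q] q(2) by simp
  moreover have "(q \<circ> p) permutes {..<length xs}"
    using p q(1) permutes_compose by blast
  ultimately show ?thesis
    using True p q sign_compose_permutes[OF q(1) p] oriented_simplex_permute_list[of xs, where ?'k = 'k]
    by (metis mult.commute of_int_mult)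
next
  case False
  then show ?thesis
    using assms by (metis mset_permute_list mult_zero_right oriented_simplex_eq_0)
qed

lemma oriented_simplex_reorder:
  assumes "q permutes {..<length xs}"
  shows "oriented_simplex (permute_list q xs) w = (of_int (sign q) * oriented_simplex xs w :: 'k::field)"
proof (cases "mset w = mset xs \<and> distinct xs")
  case True
  then have "mset w = mset (permute_list q xs)"
    using assms by simp
  then obtain p where p: "p permutes {..<length xs}" "permute_list p (permute_list q xs) = w"
    by (metis mset_eq_permutation length_permute_list)
  have w: "w = permute_list (q \<circ> p) xs"
    using permute_list_compose[OF p(1), of q] p(2) by simp
  have qp: "(q \<circ> p) permutes {..<length xs}"
    using p assms permutes_compose by blast
  have "oriented_simplex (permute_list q xs) w = (of_int (sign p) :: 'k)"
    using oriented_simplex_permute_list[of "permute_list q xs" p] True assms p by simp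
  moreover have "oriented_simplex xs w = (of_int (sign q) * of_int (sign p) :: 'k)"
    using oriented_simplex_permute_list[of xs "q \<circ> p", where ?'k = 'k] True qp w
      sign_compose_permutes[OF assms p(1)] by simp
  moreover have "of_int (sign q) * of_int (sign q) = (1 :: 'k)"
    by (metis of_int_1 of_int_mult sign_idempotent)
  ultimately show ?thesis
    by (metis mult.assoc mult_1)
next
  case False
  then show ?thesis
    using assms by (metis mset_permute_list distinct_permute_list mult_zero_right oriented_simplex_eq_0)
qed

lemma oriented_simplex_in_chains:
  assumes "length xs = Suc n" "set xs \<in> S"
  shows "(oriented_simplex xs :: _ \<Rightarrow> 'k::field) \<in> chains S n"
proof -
  have "{ys. oriented_simplex xs ys \<noteq> (0 :: 'k)} \<subseteq> (\<lambda>p. permute_list p xs) ` {p. p permutes {..<length xs}}"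
    using oriented_simplex_nonzeroD by fastforce
  then have "finite {ys. oriented_simplex xs ys \<noteq> (0 :: 'k)}"
    by (rule finite_subset) (simp add: finite_permutations)
  moreover have "length ys = Suc n \<and> distinct ys \<and> set ys \<in> S"
    if "oriented_simplex xs ys \<noteq> (0 :: 'k)" for ys
    using oriented_simplex_nonzeroD[OF that] assms by auto
  ultimately show ?thesis
    by (simp add: chains_def oriented_simplex_alternating)
qed

lemma oriented_simplex_Cons:
  assumes "distinct (v # us)"
  shows "oriented_simplex (v # us) (v # w) = (oriented_simplex us w :: 'k::field)"
proof (cases "mset w = mset us")
  case True
  then obtain q where q: "q permutes {..<length us}" "permute_list q us = w"
    by (metis mset_eq_permutation)
  define p where "p = map_permutation {..<length us} Suc q"
  have "bij_betw Suc {..<length us} {1..<Suc (length us)}"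
    by (rule bij_betwI[where g = "\<lambda>n. n - 1"]) auto
  then have p1: "p permutes {1..<Suc (length us)}"
    unfolding p_def using q(1) by (rule map_permutation_permutes)
  then have p: "p permutes {..<length (v # us)}"
    by (rule permutes_subset) auto
  have "permute_list p (v # us) = v # w"
  proof (rule nth_equalityI)
    show "length (permute_list p (v # us)) = length (v # w)"
      using q(2) by auto
  next
    fix i
    assume i: "i < length (permute_list p (v # us))"
    show "permute_list p (v # us) ! i = (v # w) ! i"
    proof (cases i)
      case 0
      then show ?thesis
        using permute_list_nth[OF p, of 0] permutes_not_in[OF p1, of 0] by simp
    next
      case (Suc j)
      then have j: "j < length us"
        using i by simp
      have "p (Suc j) = Suc (q j)"
        unfolding p_def using j by (intro map_permutation_apply) auto
      then show ?thesis
        using permute_list_nth[OF p, of i] permute_list_nth[OF q(1) j] Suc j q(2) by simp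
    qed
  qed
  moreover have "sign p = sign q"
    unfolding p_def using q(1) by (intro sign_map_permutation) auto
  ultimately show ?thesis
    using oriented_simplex_permute_list[OF assms p, where ?'k = 'k]
      oriented_simplex_permute_list[of us q, where ?'k = 'k] assms q by simp
next
  case False
  then show ?thesis
    by (simp add: oriented_simplex_eq_0)
qed

lemma oriented_simplex_swap:
  "oriented_simplex (us @ y # x # vs) w = - (oriented_simplex (us @ x # y # vs) w :: 'k::field)"
proof -
  let ?i = "length us" and ?xs = "us @ x # y # vs"
  have t: "Transposition.transpose ?i (Suc ?i) permutes {..<length ?xs}"
    by (rule permutes_swap_id) auto
  have "permute_list (Transposition.transpose ?i (Suc ?i)) ?xs = us @ y # x # vs"
  proof (rule nth_equalityI)
    fix j
    assume "j < length (permute_list (Transposition.transpose ?i (Suc ?i)) ?xs)"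
    then show "permute_list (Transposition.transpose ?i (Suc ?i)) ?xs ! j = (us @ y # x # vs) ! j"
      using permute_list_nth[OF t, of j]
      by (auto simp: nth_append nth_Cons Transposition.transpose_def split: nat.splits)
  qed simp
  then show ?thesis
    using oriented_simplex_reorder[OF t, of w, where ?'k = 'k] by (simp add: sign_swap_id)
qed

lemma oriented_simplex_move:
  "oriented_simplex (us @ x # vs) w = ((- 1) ^ length us * oriented_simplex (x # us @ vs) w :: 'k::field)"
proof (induction us arbitrary: vs rule: rev_induct)
  case (snoc u us)
  show ?case
    using oriented_simplex_swap[of us u x vs w, where ?'k = 'k] snoc[of "u # vs"] by simp
qed simp

lemma boundary_oriented_simplex:
  assumes "distinct xs" "length xs \<ge> 2"
  shows "boundary (oriented_simplex xs) w =
    (\<Sum>i<length xs. (- 1) ^ i * oriented_simplex (take i xs @ drop (Suc i) xs) w :: 'k::field)"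
proof -
  have face: "oriented_simplex xs (xs ! i # w) =
      ((- 1) ^ i * oriented_simplex (take i xs @ drop (Suc i) xs) w :: 'k)"
    if "i < length xs" for i
  proof -
    define us vs x where defs: "us = take i xs" "vs = drop (Suc i) xs" "x = xs ! i"
    have xs: "xs = us @ x # vs" and us: "length us = i"
      using that by (simp_all add: defs id_take_nth_drop[symmetric])
    then have "distinct (x # us @ vs)"
      using assms(1) by auto
    then have "oriented_simplex (us @ x # vs) (x # w) = ((- 1) ^ i * oriented_simplex (us @ vs) w :: 'k)"
      using oriented_simplex_move[of us x vs "x # w", where ?'k = 'k]
        oriented_simplex_Cons[of x "us @ vs" w, where ?'k = 'k] us by simp
    then have "oriented_simplex xs (x # w) = ((- 1) ^ i * oriented_simplex (us @ vs) w :: 'k)"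
      by (subst xs)
    then show ?thesis
      unfolding defs .
  qed
  show ?thesis
  proof (cases "w = []")
    case True
    have "oriented_simplex (take i xs @ drop (Suc i) xs) [] = (0 :: 'k)" if "i < length xs" for i
    proof -
      have "take i xs @ drop (Suc i) xs \<noteq> []"
        using that assms(2) by auto
      then have "mset [] \<noteq> mset (take i xs @ drop (Suc i) xs)"
        by (metis mset_zero_iff_right)
      then show ?thesis
        using oriented_simplex_eq_0 by blast
    qed
    then show ?thesis
      using True by (simp add: boundary_def)
  next
    case False
    have supp: "{v. oriented_simplex xs (v # w) \<noteq> (0 :: 'k)} \<subseteq> set xs"
    proof
      fix v
      assume "v \<in> {v. oriented_simplex xs (v # w) \<noteq> (0 :: 'k)}"
      then have "mset (v # w) = mset xs"
        using oriented_simplex_eq_0 by blast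
      then show "v \<in> set xs"
        by (metis list.set_intros(1) mset_eq_setD)
    qed
    have "boundary (oriented_simplex xs) w = (\<Sum>v\<in>set xs. oriented_simplex xs (v # w) :: 'k)"
      unfolding boundary_def using False supp by (simp, intro sum.mono_neutral_left) auto
    also have "\<dots> = (\<Sum>i<length xs. oriented_simplex xs (xs ! i # w))"
      using bij_betw_nth[OF assms(1), of "{..<length xs}" "set xs"]
      by (intro sum.reindex_bij_betw[symmetric]) auto
    finally show ?thesis
      using face by simp
  qed
qed

lemma push_oriented_simplex:
  assumes "distinct xs"
  shows "push f (oriented_simplex xs) = (oriented_simplex (map f xs) :: _ \<Rightarrow> 'k::field)"
proof
  fix w
  let ?A = "{ys. map f ys = w \<and> oriented_simplex xs ys \<noteq> (0 :: 'k)}"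
  show "push f (oriented_simplex xs) w = (oriented_simplex (map f xs) w :: 'k)"
  proof (cases "mset w = mset (map f xs) \<and> distinct (map f xs)")
    case True
    then obtain p where p: "p permutes {..<length xs}" "permute_list p (map f xs) = w"
      by (metis mset_eq_permutation length_map)
    have w: "w = map f (permute_list p xs)"
      using p by (simp add: permute_list_map)
    have "distinct w"
      using True by (metis mset_eq_imp_distinct_iff)
    have "ys = permute_list p xs" if "ys \<in> ?A" for ys
    proof -
      have "set ys = set xs"
        using that oriented_simplex_nonzeroD(2)[of xs ys, where ?'k = 'k] by auto
      moreover have "inj_on f (set xs)"
        using True by (simp add: distinct_map)
      ultimately show ?thesis
        using that w p(1) by (intro map_inj_on[of f]) auto
    qed
    moreover have "oriented_simplex xs (permute_list p xs) = (of_int (sign p) :: 'k)"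
      using assms p(1) by (rule oriented_simplex_permute_list)
    moreover have "of_int (sign p) \<noteq> (0 :: 'k)"
      by (simp add: sign_def)
    ultimately have "?A = {permute_list p xs}"
      using w by auto
    then have "push f (oriented_simplex xs) w = (of_int (sign p) :: 'k)"
      using \<open>distinct w\<close> assms p(1) by (simp add: push_def oriented_simplex_permute_list)
    then show ?thesis
      using True p oriented_simplex_permute_list[of "map f xs" p, where ?'k = 'k] by simp
  next
    case False
    have empty: "?A = {}" if "distinct w"
    proof -
      have "ys \<notin> ?A" for ys
      proof
        assume "ys \<in> ?A"
        then have "mset ys = mset xs" "map f ys = w"
          using oriented_simplex_eq_0[of ys xs, where ?'k = 'k] by auto
        then have "mset w = mset (map f xs)"
          by (metis mset_map)
        then show False
          using False that mset_eq_imp_distinct_iff by blast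
      qed
      then show ?thesis
        by blast
    qed
    have "push f (oriented_simplex xs) w = (0 :: 'k)"
      unfolding push_def using empty by (simp only: sum.empty if_cancel split: if_split) simp
    moreover have "oriented_simplex (map f xs) w = (0 :: 'k)"
      using False by (intro oriented_simplex_eq_0) auto
    ultimately show ?thesis
      by simp
  qed
qed

end

theory Submission
  imports Defs
begin

text \<open>
  The vertex map \<open>\<phi>\<close> sends a point to its block at scale \<open>3 r\<close>, and \<open>\<psi>\<close> sends a block at scale
  \<open>r\<close> to a chosen point of it.  Since blocks at scale \<open>r\<close> have diameter at most \<open>r\<close>, points of
  two blocks at distance at most \<open>r\<close> are at distance at most \<open>3 r\<close>, so both maps are simplicial.
  On vertices \<open>\<phi> \<circ> \<psi>\<close> is the structure map of the quotient filtration and \<open>\<phi>\<close> is natural,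
  whereas \<open>\<psi> \<circ> \<phi>\<close> is only contiguous to the inclusion and \<open>\<psi>\<close> is only natural up to
  contiguity.  Contiguous maps agree on homology: changing the map one vertex at a time reduces
  this to maps that differ at a single vertex, where an explicit cone gives the homotopy.
\<close>


section \<open>Alternating functions on lists\<close>

text \<open>The given \<open>boundary\<close> and \<open>push\<close> sum over the support of the
  chain, which changes under addition, and \<open>push\<close> kills lists with repeated entries by
  definition. The algebra is therefore done with \<open>boundary_on\<close> and
  \<open>push_on\<close>, which sum over a fixed finite vertex set and make sense for arbitrary
  functions on lists; both versions agree on suitable alternating functions, up to the value of the
  boundary at the empty list. There \<open>boundary_on\<close> is the augmented boundary, so the
  cone formula has no exception in degree zero. The prism homotopy for contiguous maps would need an
  order on the vertices of each simplex. Changing one vertex leaves a single double cone instead,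
  with no order to choose. Antisymmetry and vanishing on equal neighbours are carried as separate
  clauses, since in characteristic 2 the first does not imply the second. The two composites differ
  because a point determines its block at every scale, whereas a block does not determine a point.
  The constant is \<open>r + r + r\<close>: leave one block, cross to the other, move inside
  it.\<close>

definition alternating :: "('a list \<Rightarrow> 'k::field) \<Rightarrow> bool" where
  "alternating c \<longleftrightarrow>
     (\<forall>us x y vs. c (us @ x # y # vs) = - c (us @ y # x # vs)) \<and>
     (\<forall>us x vs. c (us @ x # x # vs) = 0)"

lemma alternating_ConsD: "alternating c \<Longrightarrow> alternating (\<lambda>w. c (x # w))"
  unfolding alternating_def append_Cons[symmetric] by blast

lemma alternating_swap: "alternating c \<Longrightarrow> c (us @ x # y # vs) = - c (us @ y # x # vs)"
  unfolding alternating_def by blast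

lemma alternating_diagonal: "alternating c \<Longrightarrow> c (us @ x # x # vs) = 0"
  unfolding alternating_def by blast

lemma alternating_move:
  "alternating c \<Longrightarrow> c (us @ x # vs @ ws) = (- 1) ^ length vs * c (us @ vs @ x # ws)"
proof (induction vs arbitrary: us)
  case (Cons v vs)
  have "c (us @ x # (v # vs) @ ws) = - c ((us @ [v]) @ x # vs @ ws)"
    using alternating_swap[OF Cons.prems, of us x v "vs @ ws"] by simp
  also have "\<dots> = - ((- 1) ^ length vs * c ((us @ [v]) @ vs @ x # ws))"
    using Cons.IH[OF Cons.prems, of "us @ [v]"] by simp
  finally show ?case
    by simp
qed simp

text \<open>Moving the left one of the two entries across \<open>vs\<close> costs the same sign on
  both sides, so only one adjacent swap remains.\<close>

lemma alternating_swap_far: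
  assumes "alternating c"
  shows "c (us @ x # vs @ y # ws) = - c (us @ y # vs @ x # ws)"
proof -
  have "c (us @ x # vs @ y # ws) = (- 1) ^ length vs * c ((us @ vs) @ x # y # ws)"
    using alternating_move[OF assms, of us x vs "y # ws"] by simp
  also have "\<dots> = - ((- 1) ^ length vs * c ((us @ vs) @ y # x # ws))"
    using alternating_swap[OF assms, of "us @ vs" x y ws] by simp
  also have "\<dots> = - c (us @ y # vs @ x # ws)"
    using alternating_move[OF assms, of us y vs "x # ws"] by simp
  finally show ?thesis .
qed

lemma alternating_nondistinct:
  assumes "alternating c" "\<not> distinct xs"
  shows "c xs = 0"
proof -
  obtain us vs ws y where "xs = us @ [y] @ vs @ [y] @ ws"
    using not_distinct_decomp[OF assms(2)] by blast
  then have "c xs = (- 1) ^ length vs * c ((us @ vs) @ y # y # ws)"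
    using alternating_move[OF assms(1), of us y vs "y # ws"] by simp
  also have "\<dots> = 0"
    using alternating_diagonal[OF assms(1), of "us @ vs"] by simp
  finally show ?thesis .
qed

lemma permute_list_transpose:
  "permute_list (Transposition.transpose (length us) (Suc (length us + length vs))) (us @ x # vs @ y # ws)
    = us @ y # vs @ x # ws" (is "permute_list ?t ?xs = ?ys")
proof (rule nth_equalityI)
  fix j
  assume j: "j < length (permute_list ?t ?xs)"
  have t: "?t permutes {..<length ?xs}"
    by (rule permutes_swap_id) auto
  have "permute_list ?t ?xs ! j = ?xs ! ?t j"
    using permute_list_nth[OF t, of j] j by simp
  also have "\<dots> = ?ys ! j"
    by (auto simp: nth_append nth_Cons Transposition.transpose_def split: nat.splits)
  finally show "permute_list ?t ?xs ! j = ?ys ! j" .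
qed simp

lemma alternating_permute_list_transpose:
  assumes c: "alternating c" and ij: "i < length xs" "j < length xs" "i \<noteq> j"
  shows "c (permute_list (Transposition.transpose i j) xs) = - c xs"
proof -
  have less: "c (permute_list (Transposition.transpose i j) xs) = - c xs"
    if "i < j" "j < length xs" for i j
  proof -
    define us vs ws where "us = take i xs" "vs = take (j - Suc i) (drop (Suc i) xs)" "ws = drop (Suc j) xs"
    note defs = this
    have "drop (Suc i) xs = vs @ drop (j - Suc i) (drop (Suc i) xs)"
      unfolding defs by (rule append_take_drop_id[symmetric])
    also have "drop (j - Suc i) (drop (Suc i) xs) = xs ! j # ws"
      using that by (simp add: defs Cons_nth_drop_Suc)
    finally have xs: "xs = us @ xs ! i # vs @ xs ! j # ws"
      using that id_take_nth_drop[of i xs] by (simp add: defs)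
    have len: "length us = i" "Suc (length us + length vs) = j"
      using that by (auto simp: defs)
    have "permute_list (Transposition.transpose i j) xs = us @ xs ! j # vs @ xs ! i # ws"
      using permute_list_transpose[of us vs "xs ! i" "xs ! j" ws] len xs by metis
    then show ?thesis
      using alternating_swap_far[OF c, of us "xs ! i" vs "xs ! j" ws] xs by simp
  qed
  show ?thesis
    using less[of i j] less[of j i] ij by (metis linorder_neqE_nat transpose_commute)
qed

text \<open>A permutation is a product of transpositions, and each of them contributes one factor -1
  to both sides.\<close>

lemma alternating_permute_list:
  assumes c: "alternating c" and p: "p permutes {..<length xs}"
  shows "c (permute_list p xs) = of_int (sign p) * c xs"
proof -
  \<comment> \<open>The list stays quantified because the induction step applies the hypothesis to
    the transposed list.\<close>
  have "\<forall>xs. length xs = n \<longrightarrow> c (permute_list p xs) = of_int (sign p) * c xs"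
    if "p permutes {..<n}" for n p
    using that finite_lessThan
  proof (induction rule: permutes_induct)
    case id
    then show ?case
      by simp
  next
    case (swap a b p)
    show ?case
    proof (intro allI impI)
      fix xs :: "'a list"
      assume xs: "length xs = n"
      let ?t = "Transposition.transpose a b"
      have t: "?t permutes {..<n}"
        using swap by (intro permutes_swap_id)
      have "permute_list (?t \<circ> p) xs = permute_list p (permute_list ?t xs)"
        using swap xs by (intro permute_list_compose) simp
      then have "c (permute_list (?t \<circ> p) xs) = - (of_int (sign p) * c xs)"
        using swap xs alternating_permute_list_transpose[OF c, of a xs b] by simp
      also have "\<dots> = of_int (sign (?t \<circ> p)) * c xs"
        using sign_compose_permutes[OF t swap.hyps(4)] swap by (simp add: sign_swap_id)
      finally show "c (permute_list (?t \<circ> p) xs) = of_int (sign (?t \<circ> p)) * c xs" .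
    qed
  qed
  then show ?thesis
    using p by blast
qed

text \<open>Adjacent swaps generate all permutations, and distinct vertices on the support come from
  vanishing at repeated entries. This form is the one that inductions on lists can use.\<close>

lemma chains_iff:
  "c \<in> chains S n \<longleftrightarrow> alternating c \<and> finite {xs. c xs \<noteq> 0} \<and>
     (\<forall>xs. c xs \<noteq> 0 \<longrightarrow> length xs = Suc n \<and> set xs \<in> S)"
proof
  assume c: "c \<in> chains S n"
  have "c (us @ x # y # vs) = - c (us @ y # x # vs)" for us x y vs
  proof -
    let ?xs = "us @ y # [] @ x # vs"
    let ?t = "Transposition.transpose (length us) (Suc (length us + length ([] :: 'a list)))"
    have "?t permutes {..<length ?xs}"
      by (rule permutes_swap_id) auto
    then have "c (permute_list ?t ?xs) = of_int (sign ?t) * c ?xs"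
      using c by (simp only: chains_def mem_Collect_eq)
    then show ?thesis
      unfolding permute_list_transpose by (simp add: sign_swap_id)
  qed
  moreover have "c (us @ x # x # vs) = 0" for us x vs
    using c by (auto simp: chains_def)
  ultimately have "alternating c"
    unfolding alternating_def by blast
  then show "alternating c \<and> finite {xs. c xs \<noteq> 0} \<and>
     (\<forall>xs. c xs \<noteq> 0 \<longrightarrow> length xs = Suc n \<and> set xs \<in> S)"
    using c unfolding chains_def by blast
next
  assume "alternating c \<and> finite {xs. c xs \<noteq> 0} \<and>
     (\<forall>xs. c xs \<noteq> 0 \<longrightarrow> length xs = Suc n \<and> set xs \<in> S)"
  then show "c \<in> chains S n"
    using alternating_nondistinct[of c] alternating_permute_list[of c] unfolding chains_def by blast
qed

text \<open>Off-diagonal terms cancel in pairs; the diagonal is a hypothesis of its own because of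
  characteristic 2.\<close>

lemma sum_antisymmetric_eq_0:
  fixes h :: "'a \<Rightarrow> 'a \<Rightarrow> 'k::field"
  assumes "finite V" "\<And>x y. h x y = - h y x" "\<And>x. h x x = 0"
  shows "(\<Sum>x\<in>V. \<Sum>y\<in>V. h x y) = 0"
  using assms(1)
proof induction
  case (insert a V)
  have "(\<Sum>x\<in>insert a V. \<Sum>y\<in>insert a V. h x y) =
      (\<Sum>y\<in>V. h a y) + (\<Sum>x\<in>V. h x a) + (\<Sum>x\<in>V. \<Sum>y\<in>V. h x y)"
    using insert by (simp add: sum.distrib assms(3))
  also have "(\<Sum>y\<in>V. h a y) = - (\<Sum>x\<in>V. h x a)"
    unfolding sum_negf[symmetric] by (intro sum.cong refl assms(2))
  finally show ?case
    using insert by simp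
qed simp


section \<open>Boundary, push-forward and cone over a finite vertex set\<close>

text \<open>A fixed \<open>V\<close> makes this visibly linear in \<open>c\<close>. At the empty
  list it is the augmentation, where \<open>boundary\<close> is zero.\<close>

definition boundary_on :: "'a set \<Rightarrow> ('a list \<Rightarrow> 'k::field) \<Rightarrow> 'a list \<Rightarrow> 'k" where
  "boundary_on V c w = (\<Sum>v\<in>V. c (v # w))"

text \<open>The sum over all preimage lists with entries in \<open>V\<close>, written recursively so
  that identities follow by induction on the target list. There is no test for distinct entries: for
  alternating \<open>c\<close> the degenerate contributions cancel by themselves.\<close>

fun push_on :: "'a set \<Rightarrow> ('a \<Rightarrow> 'b) \<Rightarrow> ('a list \<Rightarrow> 'k::field) \<Rightarrow> 'b list \<Rightarrow> 'k" where
  "push_on V f c [] = c []"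
| "push_on V f c (y # w) = (\<Sum>x | x \<in> V \<and> f x = y. push_on V f (\<lambda>z. c (x # z)) w)"

text \<open>
  On generators, \<open>vertex_cone u\<close> sends \<open>[x\<^sub>0, \<dots>, x\<^sub>n]\<close> to \<open>[u, x\<^sub>0, \<dots>, x\<^sub>n]\<close>.
\<close>

fun vertex_cone :: "'a \<Rightarrow> ('a list \<Rightarrow> 'k::field) \<Rightarrow> 'a list \<Rightarrow> 'k" where
  "vertex_cone u c [] = 0"
| "vertex_cone u c (x # w) = (if x = u then c w else 0) - vertex_cone u (\<lambda>z. c (x # z)) w"

section \<open>Linearity of the push-forward and of the cone\<close>

lemma push_on_sum: "push_on V f (\<lambda>z. \<Sum>i\<in>I. c i z) w = (\<Sum>i\<in>I. push_on V f (c i) w)"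
proof (induction w arbitrary: c)
  case (Cons y w)
  then show ?case
    by (simp, subst sum.swap) (rule refl)
qed simp

lemma push_on_zero: "push_on V f (\<lambda>z. 0) w = 0"
  by (induction w) auto

lemma push_on_uminus: "push_on V f (\<lambda>z. - c z) w = - push_on V f c w"
  by (induction w arbitrary: c) (auto simp: sum_negf)

lemma push_on_diff: "push_on V f (\<lambda>z. b z - c z) w = push_on V f b w - push_on V f c w"
  by (induction w arbitrary: b c) (auto simp: sum_subtractf)

lemma push_on_add: "push_on V f (\<lambda>z. b z + c z) w = push_on V f b w + push_on V f c w"
  by (induction w arbitrary: b c) (auto simp: sum.distrib)

lemma push_on_scale: "push_on V f (\<lambda>z. a * c z) w = a * push_on V f c w"
  by (induction w arbitrary: c) (auto simp: sum_distrib_left)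

lemma cone_sum: "vertex_cone u (\<lambda>z. \<Sum>i\<in>I. c i z) w = (\<Sum>i\<in>I. vertex_cone u (c i) w)"
  by (induction w arbitrary: c) (auto simp: sum_subtractf sum_negf)

lemma cone_zero: "vertex_cone u (\<lambda>z. 0) w = 0"
  by (induction w) auto

lemma cone_uminus: "vertex_cone u (\<lambda>z. - c z) w = - vertex_cone u c w"
  by (induction w arbitrary: c) auto

text \<open>The cone formula d(u * c) = c - u * dc. Summing over the first entry, the entry
  \<open>u\<close> yields \<open>c w\<close> and the remaining terms form a cone over the
  boundary.\<close>

lemma boundary_on_cone:
  assumes "finite V" "u \<in> V"
  shows "boundary_on V (vertex_cone u c) w = c w - vertex_cone u (boundary_on V c) w"
  using assms by (simp add: boundary_on_def[abs_def] cone_sum sum_subtractf)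

text \<open>The fibres of \<open>f\<close> over \<open>V'\<close> partition \<open>V\<close>, so
  summing over fibres and then over \<open>V'\<close> is summing over \<open>V\<close>.\<close>

lemma boundary_on_push_on:
  assumes "finite V" "finite V'" "f ` V \<subseteq> V'"
  shows "boundary_on V' (push_on V f c) w = push_on V f (boundary_on V c) w"
proof -
  have "boundary_on V' (push_on V f c) w =
      (\<Sum>y\<in>V'. \<Sum>x | x \<in> V \<and> f x = y. push_on V f (\<lambda>z. c (x # z)) w)"
    by (simp add: boundary_on_def)
  also have "\<dots> = (\<Sum>x\<in>V. push_on V f (\<lambda>z. c (x # z)) w)"
    using assms by (intro sum.group) auto
  finally show ?thesis
    by (simp add: boundary_on_def[abs_def] push_on_sum)
qed

lemma push_on_push_on:
  assumes "finite V" "finite V'" "f ` V \<subseteq> V'"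
  shows "push_on V' g (push_on V f c) w = push_on V (g \<circ> f) c w"
proof (induction w arbitrary: c)
  case (Cons z w)
  have "push_on V' g (push_on V f c) (z # w) =
      (\<Sum>y | y \<in> V' \<and> g y = z. \<Sum>x | x \<in> V \<and> f x = y.
         push_on V (g \<circ> f) (\<lambda>z. c (x # z)) w)"
    unfolding push_on.simps push_on_sum Cons ..
  also have "\<dots> = (\<Sum>y | y \<in> V' \<and> g y = z. \<Sum>x | x \<in> {x \<in> V. g (f x) = z} \<and> f x = y.
         push_on V (g \<circ> f) (\<lambda>z. c (x # z)) w)"
    by (intro sum.cong refl) auto
  also have "\<dots> = (\<Sum>x | x \<in> V \<and> g (f x) = z. push_on V (g \<circ> f) (\<lambda>z. c (x # z)) w)"
    using assms by (intro sum.group) auto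
  finally show ?case
    unfolding push_on.simps comp_apply .
qed simp

text \<open>Within the fibre over \<open>y\<close>, the apex term survives only at the vertex
  \<open>u\<close>, which lies there exactly when \<open>y = f u\<close>.\<close>

lemma push_on_cone:
  assumes "finite V" "u \<in> V"
  shows "push_on V f (vertex_cone u c) w = vertex_cone (f u) (push_on V f c) w"
proof (induction w arbitrary: c)
  case (Cons y w)
  have if_eq: "push_on V f (\<lambda>z. if x = u then c z else 0) w = (if x = u then push_on V f c w else 0)" for x and c :: "'a list \<Rightarrow> 'b"
    by (cases "x = u") (simp_all add: push_on_zero)
  have "push_on V f (vertex_cone u c) (y # w) =
      (\<Sum>x | x \<in> V \<and> f x = y. (if x = u then push_on V f c w else 0)) -
      (\<Sum>x | x \<in> V \<and> f x = y. vertex_cone (f u) (push_on V f (\<lambda>z. c (x # z))) w)"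
    by (simp add: push_on_diff if_eq Cons sum_subtractf)
  also have "(\<Sum>x | x \<in> V \<and> f x = y. (if x = u then push_on V f c w else 0)) =
      (if y = f u then push_on V f c w else 0)"
    using assms by (simp add: sum.delta)
  finally show ?case
    by (simp add: cone_sum)
qed simp

lemma push_on_cong:
  assumes "finite V" "\<And>x. x \<in> V \<Longrightarrow> x \<noteq> v \<Longrightarrow> f x = g x" "\<And>xs. v \<in> set xs \<Longrightarrow> c xs = 0"
  shows "push_on V f c w = push_on V g c w"
  using assms(3)
proof (induction w arbitrary: c)
  case (Cons y w)
  have IH: "push_on V f (\<lambda>z. c (x # z)) w = push_on V g (\<lambda>z. c (x # z)) w" for x
    using Cons.prems by (intro Cons.IH) auto
  have v: "push_on V g (\<lambda>z. c (v # z)) w = 0"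
    using Cons.prems by (simp add: push_on_zero)
  have "push_on V f c (y # w) = (\<Sum>x | x \<in> V \<and> x \<noteq> v \<and> f x = y. push_on V g (\<lambda>z. c (x # z)) w)"
    using v assms(1) unfolding push_on.simps IH by (intro sum.mono_neutral_right) auto
  also have "\<dots> = (\<Sum>x | x \<in> V \<and> x \<noteq> v \<and> g x = y. push_on V g (\<lambda>z. c (x # z)) w)"
    using assms(2) by (intro sum.cong) auto
  also have "\<dots> = push_on V g c (y # w)"
    using v assms(1) unfolding push_on.simps by (intro sum.mono_neutral_left) auto
  finally show ?case .
qed simp

text \<open>Equal neighbouring entries give a double sum of an antisymmetric function over one fibre
  taken twice. This is how simplices collapsed by \<open>f\<close> disappear.\<close>

lemma alternating_push_on:
  assumes "finite V" "alternating c"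
  shows "alternating (push_on V f c)"
proof -
  have "push_on V f c (us @ x # y # vs) = - push_on V f c (us @ y # x # vs) \<and>
      push_on V f c (us @ x # x # vs) = 0" for us x y vs
    using assms(2)
  proof (induction us arbitrary: c)
    case Nil
    have swap: "push_on V f (\<lambda>z. c (a # b # z)) vs = - push_on V f (\<lambda>z. c (b # a # z)) vs" for a b
    proof -
      have "(\<lambda>z. c (a # b # z)) = (\<lambda>z. - c (b # a # z))"
        using alternating_swap[OF Nil, of "[]" a b] by simp
      then show ?thesis
        by (simp add: push_on_uminus)
    qed
    have diag: "push_on V f (\<lambda>z. c (a # a # z)) vs = 0" for a
      using alternating_diagonal[OF Nil, of "[]"] by (simp add: push_on_zero)
    have "push_on V f c (x # y # vs) = - push_on V f c (y # x # vs)"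
    proof -
      have "push_on V f c (x # y # vs) = (\<Sum>a | a \<in> V \<and> f a = x. \<Sum>b | b \<in> V \<and> f b = y.
          - push_on V f (\<lambda>z. c (b # a # z)) vs)"
        unfolding push_on.simps by (intro sum.cong refl swap)
      also have "\<dots> = - push_on V f c (y # x # vs)"
        unfolding push_on.simps sum_negf by (subst sum.swap) (rule refl)
      finally show ?thesis .
    qed
    moreover have "push_on V f c (x # x # vs) = 0"
      unfolding push_on.simps by (rule sum_antisymmetric_eq_0[OF _ swap diag]) (use assms(1) in simp)
    ultimately show ?case
      unfolding append_Nil ..
  next
    case (Cons u us)
    have "alternating (\<lambda>z. c (a # z))" for a
      using Cons.prems by (rule alternating_ConsD)
    note IH = Cons.IH[OF this]
    have "push_on V f c ((u # us) @ x # y # vs) = - push_on V f c ((u # us) @ y # x # vs)"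
      unfolding append_Cons push_on.simps sum_negf[symmetric] using IH by (intro sum.cong) auto
    moreover have "push_on V f c ((u # us) @ x # x # vs) = 0"
      using IH by simp
    ultimately show ?case ..
  qed
  then show ?thesis
    unfolding alternating_def by blast
qed

text \<open>At \<open>x # y # vs\<close> the cone is
  \<open>[x = u] c (y # vs) - [y = u] c (x # vs)\<close> plus a cone over the slice at
  \<open>x\<close>, \<open>y\<close>, which is antisymmetric in \<open>x\<close> and
  \<open>y\<close> and zero for \<open>x = y\<close>.\<close>

lemma alternating_cone:
  assumes "alternating c"
  shows "alternating (vertex_cone u c)"
proof -
  have "vertex_cone u c (us @ x # y # vs) = - vertex_cone u c (us @ y # x # vs) \<and>
      vertex_cone u c (us @ x # x # vs) = 0" for us x y vs
    using assms
  proof (induction us arbitrary: c)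
    case Nil
    have "(\<lambda>z. c (x # y # z)) = (\<lambda>z. - c (y # x # z))"
      using alternating_swap[OF Nil, of "[]" x y] by simp
    then have "vertex_cone u (\<lambda>z. c (x # y # z)) vs = - vertex_cone u (\<lambda>z. c (y # x # z)) vs"
      by (simp add: cone_uminus)
    moreover have "vertex_cone u (\<lambda>z. c (x # x # z)) vs = 0"
      using alternating_diagonal[OF Nil, of "[]"] by (simp add: cone_zero)
    ultimately show ?case
      by simp
  next
    case (Cons a us)
    have "alternating (\<lambda>z. c (a # z))"
      using Cons.prems by (rule alternating_ConsD)
    note IH = Cons.IH[OF this]
    then show ?case
      using alternating_swap[OF Cons.prems, of us x y vs] alternating_diagonal[OF Cons.prems, of us x vs]
      by simp
  qed
  then show ?thesis
    unfolding alternating_def by blast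
qed

section \<open>Supports of cones and push-forwards\<close>

lemma cone_nonzeroD:
  "vertex_cone u c w \<noteq> 0 \<Longrightarrow> \<exists>z. c z \<noteq> 0 \<and> length w = Suc (length z) \<and> set w = insert u (set z)"
proof (induction w arbitrary: c)
  case (Cons x w)
  show ?case
  proof (cases "x = u \<and> c w \<noteq> 0")
    case True
    then show ?thesis
      by (intro exI[of _ w]) auto
  next
    case False
    then have "vertex_cone u (\<lambda>z. c (x # z)) w \<noteq> 0"
      using Cons.prems by (auto split: if_splits)
    then obtain z where "c (x # z) \<noteq> 0" "length w = Suc (length z)" "set w = insert u (set z)"
      using Cons.IH by blast
    then show ?thesis
      by (intro exI[of _ "x # z"]) auto
  qed
qed simp

lemma push_on_nonzeroD: "push_on V f c w \<noteq> 0 \<Longrightarrow> \<exists>z. c z \<noteq> 0 \<and> set z \<subseteq> V \<and> map f z = w"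
proof (induction w arbitrary: c)
  case (Cons y w)
  then obtain x where x: "x \<in> V" "f x = y" "push_on V f (\<lambda>z. c (x # z)) w \<noteq> 0"
    by (auto elim: sum.not_neutral_contains_not_neutral)
  then obtain z where "c (x # z) \<noteq> 0" "set z \<subseteq> V" "map f z = w"
    using Cons.IH by blast
  with x show ?case
    by (intro exI[of _ "x # z"]) auto
qed auto

lemma push_on_eq_sum:
  "push_on V f c w = (\<Sum>xs | set xs \<subseteq> V \<and> map f xs = w. c xs)"
proof (induction w arbitrary: c)
  case Nil
  have "{xs. set xs \<subseteq> V \<and> xs = []} = {[]}"
    by auto
  then show ?case
    by simp
next
  case (Cons y w)
  let ?Z = "{z. set z \<subseteq> V \<and> map f z = w}"
  have "{xs. set xs \<subseteq> V \<and> map f xs = y # w} = (\<lambda>(x, z). x # z) ` ({x \<in> V. f x = y} \<times> ?Z)"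
    by (force simp: map_eq_Cons_conv)
  then have "(\<Sum>xs | set xs \<subseteq> V \<and> map f xs = y # w. c xs) =
      sum c ((\<lambda>(x, z). x # z) ` ({x \<in> V. f x = y} \<times> ?Z))"
    by (rule arg_cong)
  also have "\<dots> = (\<Sum>(x, z)\<in>{x \<in> V. f x = y} \<times> ?Z. c (x # z))"
    by (subst sum.reindex) (auto simp: inj_on_def case_prod_unfold)
  also have "\<dots> = (\<Sum>x | x \<in> V \<and> f x = y. \<Sum>z\<in>?Z. c (x # z))"
    by (simp add: sum.cartesian_product)
  finally show ?case
    using Cons by simp
qed


section \<open>Chains, boundaries and induced chain maps\<close>

text \<open>\<open>V\<close> only has to contain the vertices that occur, so that several chains can
  share one \<open>V\<close>.\<close>

definition supported :: "'a set \<Rightarrow> ('a list \<Rightarrow> 'k::field) \<Rightarrow> bool" where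
  "supported V c \<longleftrightarrow> finite V \<and> (\<forall>xs. c xs \<noteq> 0 \<longrightarrow> set xs \<subseteq> V)"

definition abstract_complex :: "'a set set \<Rightarrow> bool" where
  "abstract_complex S \<longleftrightarrow> (\<forall>\<sigma>\<in>S. \<sigma> \<noteq> {} \<and> (\<forall>\<tau>. \<tau> \<noteq> {} \<and> \<tau> \<subseteq> \<sigma> \<longrightarrow> \<tau> \<in> S))"

definition function_subspace :: "('b \<Rightarrow> 'k::field) set \<Rightarrow> bool" where
  "function_subspace A \<longleftrightarrow> (\<lambda>_. 0) \<in> A \<and> (\<forall>b\<in>A. \<forall>c\<in>A. (\<lambda>x. b x + c x) \<in> A) \<and>
     (\<forall>a. \<forall>c\<in>A. (\<lambda>x. a * c x) \<in> A)"

lemma function_subspace_zero: "function_subspace A \<Longrightarrow> (\<lambda>_. 0) \<in> A"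
  by (simp add: function_subspace_def)

lemma function_subspace_add: "function_subspace A \<Longrightarrow> b \<in> A \<Longrightarrow> c \<in> A \<Longrightarrow> (\<lambda>x. b x + c x) \<in> A"
  by (simp add: function_subspace_def)

lemma function_subspace_scale: "function_subspace A \<Longrightarrow> c \<in> A \<Longrightarrow> (\<lambda>x. a * c x) \<in> A"
  by (simp add: function_subspace_def)

lemma chains_supported:
  assumes "c \<in> chains S n"
  obtains V where "supported V c"
proof
  show "supported (\<Union>(set ` {xs. c xs \<noteq> 0})) c"
    using assms by (auto simp: supported_def chains_def)
qed

text \<open>Only finitely many lists of length \<open>Suc n\<close> have their entries in
  \<open>V\<close>, which gives the finite support.\<close>

lemma chainsI:
  assumes "alternating c" "supported V c" "\<And>xs. c xs \<noteq> 0 \<Longrightarrow> length xs = Suc n \<and> set xs \<in> S"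
  shows "c \<in> chains S n"
proof -
  have "finite {xs. c xs \<noteq> 0}"
    by (rule finite_subset[OF _ finite_lists_length_eq[of V "Suc n"]])
      (use assms in \<open>auto simp: supported_def\<close>)
  then show ?thesis
    using assms unfolding chains_iff by blast
qed

lemma chains_alternating: "c \<in> chains S n \<Longrightarrow> alternating c"
  by (simp add: chains_iff)

lemma chainsD: "c \<in> chains S n \<Longrightarrow> c xs \<noteq> 0 \<Longrightarrow> length xs = Suc n \<and> set xs \<in> S"
  by (simp add: chains_iff)

lemma alternating_linear:
  assumes "alternating b" "alternating c"
  shows "alternating (\<lambda>w. b w + a * c w)"
proof -
  have "b (us @ x # y # vs) + a * c (us @ x # y # vs) = - (b (us @ y # x # vs) + a * c (us @ y # x # vs))"
    for us x y vs
    using alternating_swap[OF assms(1), of us x y vs] alternating_swap[OF assms(2), of us x y vs]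
    by (simp add: algebra_simps)
  moreover have "b (us @ x # x # vs) + a * c (us @ x # x # vs) = 0" for us x vs
    using alternating_diagonal[OF assms(1), of us x vs] alternating_diagonal[OF assms(2), of us x vs]
    by simp
  ultimately show ?thesis
    unfolding alternating_def by blast
qed

lemma boundary_eq:
  assumes "supported V c"
  shows "boundary c w = (if w = [] then 0 else boundary_on V c w)"
proof -
  have "(\<Sum>v | c (v # w) \<noteq> 0. c (v # w)) = (\<Sum>v\<in>V. c (v # w))"
    using assms by (intro sum.mono_neutral_left) (auto simp: supported_def)
  then show ?thesis
    by (simp add: boundary_def boundary_on_def)
qed

text \<open>A chain of degree at least one vanishes on one-element lists, so the augmentation at the
  empty list is zero as well.\<close>

lemma boundary_eq_on:
  assumes "c \<in> chains S (Suc n)" "supported V c"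
  shows "boundary c = boundary_on V c"
proof
  fix w
  have "c [v] = 0" for v
    using chainsD[OF assms(1), of "[v]"] by auto
  then show "boundary c w = boundary_on V c w"
    using boundary_eq[OF assms(2)] by (simp add: boundary_on_def)
qed

text \<open>At a list with repeated entries the left side is zero by definition, the right side
  because it is alternating.\<close>

lemma push_eq_push_on:
  assumes "alternating c" "supported V c"
  shows "push f c = push_on V f c"
proof
  fix w
  show "push f c w = push_on V f c w"
  proof (cases "distinct w")
    case True
    have "{xs. set xs \<subseteq> V \<and> map f xs = w} \<subseteq> {xs. set xs \<subseteq> V \<and> length xs = length w}"
      by auto
    then have "finite {xs. set xs \<subseteq> V \<and> map f xs = w}"
      using assms(2) finite_lists_length_eq finite_subset unfolding supported_def by blast
    then have "(\<Sum>xs | map f xs = w \<and> c xs \<noteq> 0. c xs) = (\<Sum>xs | set xs \<subseteq> V \<and> map f xs = w. c xs)"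
      using assms(2) by (intro sum.mono_neutral_left) (auto simp: supported_def)
    with True show ?thesis
      by (simp add: push_def push_on_eq_sum)
  next
    case False
    moreover have "alternating (push_on V f c)"
      using assms by (intro alternating_push_on) (auto simp: supported_def)
    ultimately show ?thesis
      using alternating_nondistinct[of "push_on V f c" w] by (simp add: push_def)
  qed
qed

lemma supported_push_on: "supported V c \<Longrightarrow> supported (f ` V) (push_on V f c)"
  using push_on_nonzeroD[of V f c] by (fastforce simp: supported_def)

lemma alternating_boundary:
  assumes "alternating c" "supported V c"
  shows "alternating (boundary c)"
proof -
  have "boundary c (us @ x # y # vs) = - boundary c (us @ y # x # vs)" for us x y vs
  proof -
    have "boundary c (us @ x # y # vs) = (\<Sum>v\<in>V. c ((v # us) @ x # y # vs))"
      by (simp add: boundary_eq[OF assms(2)] boundary_on_def)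
    also have "\<dots> = (\<Sum>v\<in>V. - c ((v # us) @ y # x # vs))"
      by (intro sum.cong refl alternating_swap assms(1))
    also have "\<dots> = - boundary c (us @ y # x # vs)"
      by (simp add: boundary_eq[OF assms(2)] boundary_on_def sum_negf)
    finally show ?thesis .
  qed
  moreover have "boundary c (us @ x # x # vs) = 0" for us x vs
    using alternating_diagonal[OF assms(1), of "_ # us" x vs]
    by (simp add: boundary_eq[OF assms(2)] boundary_on_def)
  ultimately show ?thesis
    unfolding alternating_def by blast
qed

lemma supported_boundary:
  assumes "supported V c"
  shows "supported V (boundary c)"
proof -
  have "set w \<subseteq> V" if w: "boundary c w \<noteq> 0" for w
  proof -
    obtain v where "c (v # w) \<noteq> 0"
      using w by (auto simp: boundary_eq[OF assms] boundary_on_def split: if_splits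
          elim: sum.not_neutral_contains_not_neutral)
    then show ?thesis
      using assms by (fastforce simp: supported_def)
  qed
  then show ?thesis
    using assms by (simp add: supported_def)
qed

lemma boundary_in_chains:
  assumes "abstract_complex S" "c \<in> chains S (Suc n)"
  shows "boundary c \<in> chains S n"
proof -
  obtain V where V: "supported V c"
    using chains_supported[OF assms(2)] .
  show ?thesis
  proof (rule chainsI)
    show "alternating (boundary c)"
      using alternating_boundary chains_alternating[OF assms(2)] V by blast
    show "supported V (boundary c)"
      using V by (rule supported_boundary)
    fix w
    assume w: "boundary c w \<noteq> 0"
    obtain v where v: "c (v # w) \<noteq> 0"
      using w by (auto simp: boundary_eq[OF V] boundary_on_def split: if_splits
          elim: sum.not_neutral_contains_not_neutral)
    have "w \<noteq> []"
      using w by (auto simp: boundary_def)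
    then show "length w = Suc n \<and> set w \<in> S"
      using assms(1) chainsD[OF assms(2) v] unfolding abstract_complex_def
      by (metis length_Cons nat.inject set_empty set_subset_Cons)
  qed
qed

text \<open>The two orders in which a pair of vertices is removed have opposite signs.\<close>

lemma boundary_boundary:
  assumes "c \<in> chains S n"
  shows "boundary (boundary c) = (\<lambda>_. 0)"
proof
  fix w
  obtain V where V: "supported V c"
    using chains_supported[OF assms] .
  have c: "alternating c"
    using assms by (rule chains_alternating)
  have "(\<Sum>u\<in>V. \<Sum>v\<in>V. c (v # u # w)) = 0"
  proof (rule sum_antisymmetric_eq_0)
    show "finite V"
      using V by (simp add: supported_def)
    show "c (v # u # w) = - c (u # v # w)" for u v
      using alternating_swap[OF c, of "[]" v u w] by simp
    show "c (u # u # w) = 0" for u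
      using alternating_diagonal[OF c, of "[]" u w] by simp
  qed
  then show "boundary (boundary c) w = 0"
    by (simp add: boundary_eq[OF supported_boundary[OF V]] boundary_eq[OF V] boundary_on_def)
qed

lemma push_in_chains:
  assumes "\<And>\<sigma>. \<sigma> \<in> S \<Longrightarrow> f ` \<sigma> \<in> T" "c \<in> chains S n"
  shows "push f c \<in> chains T n"
proof -
  obtain V where V: "supported V c"
    using chains_supported[OF assms(2)] .
  have c: "alternating c"
    using assms(2) by (rule chains_alternating)
  have "push_on V f c \<in> chains T n"
  proof (rule chainsI)
    show "alternating (push_on V f c)"
      using V c by (intro alternating_push_on) (auto simp: supported_def)
    show "supported (f ` V) (push_on V f c)"
      using V by (rule supported_push_on)
    fix w
    assume "push_on V f c w \<noteq> 0"
    then obtain z where "c z \<noteq> 0" "map f z = w"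
      using push_on_nonzeroD by blast
    then show "length w = Suc n \<and> set w \<in> T"
      using chainsD[OF assms(2)] assms(1) by fastforce
  qed
  then show ?thesis
    by (simp add: push_eq_push_on[OF c V])
qed

lemma boundary_push:
  assumes "c \<in> chains S n"
  shows "boundary (push f c) = push f (boundary c)"
proof
  fix w
  obtain V where V: "supported V c"
    using chains_supported[OF assms] .
  then have fin: "finite V"
    by (simp add: supported_def)
  have c: "alternating c"
    using assms by (rule chains_alternating)
  have push_boundary: "push f (boundary c) = push_on V f (boundary c)"
    using alternating_boundary[OF c V] supported_boundary[OF V] by (rule push_eq_push_on)
  show "boundary (push f c) w = push f (boundary c) w"
  proof (cases "w = []")
    case True
    then show ?thesis
      unfolding push_boundary by (simp add: boundary_def)
  next
    case False
    then have "boundary (push f c) w = boundary_on (f ` V) (push_on V f c) w"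
      using boundary_eq[OF supported_push_on[OF V], of f w] by (simp add: push_eq_push_on[OF c V])
    also have "\<dots> = push_on V f (boundary_on V c) w"
      using fin by (intro boundary_on_push_on) auto
    \<comment> \<open>Preimages of the nonempty list \<open>w\<close> are nonempty, and there
      \<open>boundary\<close> and \<open>boundary_on\<close> agree.\<close>
    also have "\<dots> = push_on V f (boundary c) w"
      using False unfolding push_on_eq_sum by (intro sum.cong) (auto simp: boundary_eq[OF V])
    finally show ?thesis
      by (simp add: push_boundary)
  qed
qed

lemma push_push:
  assumes "c \<in> chains S n"
  shows "push g (push f c) = push (g \<circ> f) c"
proof -
  obtain V where V: "supported V c"
    using chains_supported[OF assms] .
  have c: "alternating c"
    using assms by (rule chains_alternating)
  have "alternating (push_on V f c)"
    using V c by (intro alternating_push_on) (auto simp: supported_def)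
  then have "push g (push f c) = push_on (f ` V) g (push_on V f c)"
    using push_eq_push_on[OF c V] push_eq_push_on supported_push_on[OF V] by metis
  also have "\<dots> = push_on V (g \<circ> f) c"
    using V by (intro ext push_on_push_on) (auto simp: supported_def)
  finally show ?thesis
    by (simp add: push_eq_push_on[OF c V])
qed

lemma push_ident:
  assumes "c \<in> chains S n"
  shows "push (\<lambda>x. x) c = c"
proof
  fix w
  obtain V where V: "supported V c"
    using chains_supported[OF assms] .
  have "{xs. set xs \<subseteq> V \<and> xs = w} = (if set w \<subseteq> V then {w} else {})"
    by auto
  moreover have "c w = 0" if "\<not> set w \<subseteq> V"
    using V that by (auto simp: supported_def)
  ultimately show "push (\<lambda>x. x) c w = c w"
    by (simp add: push_eq_push_on[OF chains_alternating[OF assms] V] push_on_eq_sum)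
qed

section \<open>Linearity on chains, and the spaces of cycles and boundaries\<close>

lemma common_support:
  assumes "b \<in> chains S n" "c \<in> chains T m"
  obtains V where "supported V b" "supported V c"
proof -
  obtain U W where "supported U b" "supported W c"
    using chains_supported[OF assms(1)] chains_supported[OF assms(2)] by metis
  then have "supported (U \<union> W) b" "supported (U \<union> W) c"
    by (auto simp: supported_def)
  then show ?thesis
    using that by blast
qed

lemma supported_linear:
  assumes "supported V b" "supported V c"
  shows "supported V (\<lambda>w. b w + a * c w)"
proof -
  have "b xs \<noteq> 0 \<or> c xs \<noteq> 0" if "b xs + a * c xs \<noteq> 0" for xs
    using that by auto
  then show ?thesis
    using assms unfolding supported_def by blast
qed

lemma chains_linear:
  assumes "b \<in> chains S n" "c \<in> chains S n"
  shows "(\<lambda>w. b w + a * c w) \<in> chains S n"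
proof -
  obtain V where V: "supported V b" "supported V c"
    using common_support[OF assms] .
  show ?thesis
  proof (rule chainsI)
    show "alternating (\<lambda>w. b w + a * c w)"
      using assms by (intro alternating_linear chains_alternating)
    show "supported V (\<lambda>w. b w + a * c w)"
      using V by (rule supported_linear)
    fix w
    assume "b w + a * c w \<noteq> 0"
    then have "b w \<noteq> 0 \<or> c w \<noteq> 0"
      by auto
    then show "length w = Suc n \<and> set w \<in> S"
      using chainsD[OF assms(1)] chainsD[OF assms(2)] by blast
  qed
qed

lemma boundary_linear:
  assumes "b \<in> chains S n" "c \<in> chains S n"
  shows "boundary (\<lambda>w. b w + a * c w) = (\<lambda>w. boundary b w + a * boundary c w)"
proof -
  obtain V where V: "supported V b" "supported V c"
    using common_support[OF assms] .
  show ?thesis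
    by (simp add: fun_eq_iff boundary_eq[OF supported_linear[OF V]] boundary_eq[OF V(1)]
        boundary_eq[OF V(2)] boundary_on_def sum.distrib sum_distrib_left)
qed

lemma push_linear:
  assumes "b \<in> chains S n" "c \<in> chains S n"
  shows "push f (\<lambda>w. b w + a * c w) = (\<lambda>w. push f b w + a * push f c w)"
proof -
  obtain V where V: "supported V b" "supported V c"
    using common_support[OF assms] .
  have bc: "alternating b" "alternating c"
    using assms by (auto intro: chains_alternating)
  show ?thesis
    by (simp add: fun_eq_iff push_eq_push_on[OF alternating_linear[OF bc] supported_linear[OF V]]
        push_eq_push_on[OF bc(1) V(1)] push_eq_push_on[OF bc(2) V(2)] push_on_add push_on_scale)
qed

lemma zero_in_chains: "(\<lambda>_. 0) \<in> chains S n"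
  by (simp add: chains_def)

lemma boundary_zero: "boundary (\<lambda>_. 0) = (\<lambda>_. 0)"
  by (simp add: boundary_def fun_eq_iff)

lemma push_zero: "push f (\<lambda>_. 0) = (\<lambda>_. 0)"
  by (simp add: push_def fun_eq_iff)

lemma push_add:
  assumes "b \<in> chains S n" "c \<in> chains S n"
  shows "push f (\<lambda>w. b w + c w) = (\<lambda>w. push f b w + push f c w)"
  using push_linear[OF assms, of f 1] by simp

lemma push_scale:
  assumes "c \<in> chains S n"
  shows "push f (\<lambda>w. a * c w) = (\<lambda>w. a * push f c w)"
  using push_linear[OF zero_in_chains assms, of f a] by (simp add: push_zero)

lemma function_subspaceI:
  assumes "(\<lambda>_. 0) \<in> A" "\<And>a b c. b \<in> A \<Longrightarrow> c \<in> A \<Longrightarrow> (\<lambda>x. b x + a * c x) \<in> A"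
  shows "function_subspace A"
proof -
  have "(\<lambda>x. b x + c x) \<in> A" if "b \<in> A" "c \<in> A" for b c
    using assms(2)[OF that, of 1] by simp
  moreover have "(\<lambda>x. a * c x) \<in> A" if "c \<in> A" for a c
    using assms(2)[OF assms(1) that, of a] by simp
  ultimately show ?thesis
    using assms(1) by (simp add: function_subspace_def)
qed

lemma function_subspace_cycles: "function_subspace (cycles S n)"
proof (rule function_subspaceI)
  show "(\<lambda>_. 0) \<in> cycles S n"
    by (simp add: cycles_def zero_in_chains boundary_zero)
  show "(\<lambda>x. b x + a * c x) \<in> cycles S n" if "b \<in> cycles S n" "c \<in> cycles S n" for a b c
    using that by (auto simp: cycles_def chains_linear boundary_linear)
qed

lemma function_subspace_boundaries: "function_subspace (boundaries S n)"
proof (rule function_subspaceI)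
  show "(\<lambda>_. 0) \<in> boundaries S n"
    unfolding boundaries_def by (rule image_eqI[where x = "\<lambda>_. 0"]) (simp_all add: boundary_zero zero_in_chains)
  show "(\<lambda>x. b x + a * c x) \<in> boundaries S n"
    if bc: "b \<in> boundaries S n" "c \<in> boundaries S n" for a b c
  proof -
    obtain b' c' where "b' \<in> chains S (Suc n)" "c' \<in> chains S (Suc n)"
      and bc': "b = boundary b'" "c = boundary c'"
      using bc by (auto simp: boundaries_def)
    note chains = this(1,2)
    show ?thesis
      unfolding boundaries_def bc' boundary_linear[OF chains, symmetric]
      by (rule imageI[OF chains_linear[OF chains]])
  qed
qed

lemma boundaries_subset_cycles: "abstract_complex S \<Longrightarrow> boundaries S n \<subseteq> cycles S n"
  by (auto simp: boundaries_def cycles_def boundary_in_chains boundary_boundary)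

lemma push_in_cycles:
  assumes "\<And>\<sigma>. \<sigma> \<in> S \<Longrightarrow> f ` \<sigma> \<in> T" "c \<in> cycles S n"
  shows "push f c \<in> cycles T n"
proof -
  have c: "c \<in> chains S n" "boundary c = (\<lambda>_. 0)"
    using assms(2) by (auto simp: cycles_def)
  then have "push f c \<in> chains T n"
    using assms(1) push_in_chains by blast
  then show ?thesis
    using boundary_push[OF c(1), of f] by (simp add: cycles_def c(2) push_zero)
qed

lemma push_in_boundaries:
  assumes "\<And>\<sigma>. \<sigma> \<in> S \<Longrightarrow> f ` \<sigma> \<in> T" "c \<in> boundaries S n"
  shows "push f c \<in> boundaries T n"
proof -
  obtain b where b: "b \<in> chains S (Suc n)" "c = boundary b"
    using assms(2) by (auto simp: boundaries_def)
  then have "push f c = boundary (push f b)"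
    by (simp add: boundary_push)
  moreover have "push f b \<in> chains T (Suc n)"
    using assms(1) b(1) by (rule push_in_chains)
  ultimately show ?thesis
    by (simp add: boundaries_def)
qed


section \<open>Contiguous simplicial maps\<close>

text \<open>
  If \<open>a\<close> is the link part of the cycle \<open>c\<close> at \<open>v\<close>, so that \<open>c = v * a\<close> up to terms without \<open>v\<close>,
  then \<open>a\<close> is a cycle and the difference of the two images of \<open>c\<close> is
  \<open>(g v - f v) * push f a\<close>, which is the boundary of \<open>f v * g v * push f a\<close>.
\<close>

lemma push_change_vertex:
  fixes f g :: "'a \<Rightarrow> 'b" and c :: "'a list \<Rightarrow> 'k::field"
  assumes T: "abstract_complex T" and fg: "\<And>\<sigma>. \<sigma> \<in> S \<Longrightarrow> f ` \<sigma> \<union> g ` \<sigma> \<in> T"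
    and eq: "\<And>x. x \<noteq> v \<Longrightarrow> f x = g x" and c: "c \<in> cycles S n"
  shows "(\<lambda>w. push g c w - push f c w) \<in> boundaries T n"
proof -
  have chain: "c \<in> chains S n"
    using c by (simp add: cycles_def)
  then have alt: "alternating c"
    by (rule chains_alternating)
  obtain U where "supported U c"
    using chains_supported[OF chain] .
  then have V: "supported (insert v U) c"
    by (auto simp: supported_def)
  define V where "V = insert v U"
  have V: "supported V c" "finite V" "v \<in> V"
    using V by (auto simp: V_def supported_def)
  define a where "a = (\<lambda>w. c (v # w))"
  define p where "p = push_on V f a"
  define E where "E = vertex_cone (f v) (vertex_cone (g v) p)"
  define b where "b = (\<lambda>w. c w + (- 1) * vertex_cone v a w)"
  define V' where "V' = f ` V \<union> g ` V"
  have alt_a: "alternating a"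
    unfolding a_def using alt by (rule alternating_ConsD)
  have alt_p: "alternating p"
    unfolding p_def using V alt_a by (intro alternating_push_on)
  have a_v: "a xs = 0" if "v \<in> set xs" for xs
    using that alternating_nondistinct[OF alt, of "v # xs"] by (simp add: a_def)
  have boundary_a: "boundary_on V a = (\<lambda>_. 0)"
  proof
    fix w
    \<comment> \<open>Since \<open>v # w\<close> is never empty, the cycle condition on
      \<open>c\<close> applies even at \<open>w = []\<close>, where \<open>boundary_on\<close> is
      the augmentation.\<close>
    have "boundary_on V a w = (\<Sum>u\<in>V. - c (u # v # w))"
      unfolding boundary_on_def a_def
      by (intro sum.cong refl) (use alternating_swap[OF alt, of "[]" v] in simp)
    also have "\<dots> = - boundary c (v # w)"
      by (simp add: boundary_eq[OF V(1)] boundary_on_def sum_negf)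
    finally show "boundary_on V a w = 0"
      using c by (simp add: cycles_def)
  qed
  have alt_b: "alternating b"
    unfolding b_def using alt alternating_cone[OF alt_a] by (rule alternating_linear)
  \<comment> \<open>With \<open>v\<close> in front, the apex term of the cone reproduces
    \<open>a\<close> and the rest vanishes because the link avoids \<open>v\<close>. Alternation
    moves \<open>v\<close> to the front from any other position.\<close>
  have b_v: "b xs = 0" if v: "v \<in> set xs" for xs
  proof -
    have "(\<lambda>z. a (v # z)) = (\<lambda>_. 0)"
      using a_v by auto
    then have "b (v # z) = 0" for z
      by (simp add: b_def a_def cone_zero)
    moreover obtain us ws where "xs = us @ v # ws"
      using split_list[OF v] by blast
    ultimately show ?thesis
      using alternating_move[OF alt_b, of "[]" v us ws] by simp
  qed
  \<comment> \<open>The link avoids the only vertex at which the two maps may differ.\<close>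
  have p_g: "push_on V g a = p"
    unfolding p_def using V(2) eq a_v by (intro ext push_on_cong[symmetric]) auto
  have boundary_p: "boundary_on V' p = (\<lambda>_. 0)"
  proof
    fix w
    have "boundary_on V' p w = push_on V f (boundary_on V a) w"
      unfolding p_def V'_def using V(2) by (intro boundary_on_push_on) auto
    then show "boundary_on V' p w = 0"
      by (simp add: boundary_a push_on_zero)
  qed
  have diff: "push g c w - push f c w = vertex_cone (g v) p w - vertex_cone (f v) p w" for w
  proof -
    have c_eq: "c = (\<lambda>w. vertex_cone v a w + b w)"
      by (simp add: b_def)
    have "push_on V h c w = vertex_cone (h v) (push_on V h a) w + push_on V h b w" for h :: "'a \<Rightarrow> 'b"
      unfolding push_on_cone[OF V(2,3), symmetric] by (subst c_eq) (rule push_on_add)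
    moreover have "push_on V f b w = push_on V g b w"
      using V(2) eq b_v by (intro push_on_cong) auto
    ultimately show ?thesis
      unfolding push_eq_push_on[OF alt V(1)] by (simp add: p_g p_def[symmetric])
  qed
  \<comment> \<open>Here contiguity enters: a list in the support of \<open>E\<close> uses
    \<open>f v\<close>, \<open>g v\<close> and images of some \<open>x\<close> with
    \<open>v # x\<close> a simplex of \<open>S\<close>, so it spans a face of the union of the two
    images of that simplex. The two apexes on a link of degree one less give \<open>n + 2\<close>
    entries.\<close>
  have supp_E: "length w = Suc (Suc n) \<and> set w \<in> T \<and> set w \<subseteq> V'" if w: "E w \<noteq> 0" for w
  proof -
    obtain y where y: "vertex_cone (g v) p y \<noteq> 0" "length w = Suc (length y)"
      "set w = insert (f v) (set y)"
      using cone_nonzeroD[OF w[unfolded E_def]] by blast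
    obtain z where z: "p z \<noteq> 0" "length y = Suc (length z)" "set y = insert (g v) (set z)"
      using cone_nonzeroD[OF y(1)] by blast
    obtain x where x: "a x \<noteq> 0" "set x \<subseteq> V" "map f x = z"
      using push_on_nonzeroD[OF z(1)[unfolded p_def]] by blast
    have simplex: "length (v # x) = Suc n" "set (v # x) \<in> S"
      using chainsD[OF chain x(1)[unfolded a_def]] by auto
    have "set w \<noteq> {}" "set w \<subseteq> f ` set (v # x) \<union> g ` set (v # x)"
      using y(3) z(3) x(3) by auto
    then have "set w \<in> T"
      using T fg[OF simplex(2)] unfolding abstract_complex_def by blast
    moreover have "set w \<subseteq> V'"
      using image_mono[OF x(2), of f] x(3) V(3) y(3) z(3) unfolding V'_def by auto
    moreover have "length w = Suc (Suc n)"
      using simplex(1) x(3) y(2) z(2) by auto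
    ultimately show ?thesis
      by blast
  qed
  have E: "supported V' E" "alternating E"
    using supp_E V(2) alt_p by (auto simp: supported_def V'_def E_def intro!: alternating_cone)
  then have E_chain: "E \<in> chains T (Suc n)"
    using chainsI[OF E(2,1)] supp_E by blast
  have "boundary E = (\<lambda>w. push g c w - push f c w)"
  proof
    fix w
    have V': "finite V'" "f v \<in> V'" "g v \<in> V'"
      using V by (auto simp: V'_def)
    have "boundary_on V' (vertex_cone (g v) p) = p"
      by (simp add: fun_eq_iff boundary_on_cone[OF V'(1,3)] boundary_p cone_zero)
    then have "boundary_on V' E w = vertex_cone (g v) p w - vertex_cone (f v) p w"
      unfolding E_def by (simp add: boundary_on_cone[OF V'(1,2)])
    then show "boundary E w = push g c w - push f c w"
      by (simp add: boundary_eq_on[OF E_chain E(1)] diff)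
  qed
  then show ?thesis
    using E_chain unfolding boundaries_def by (metis imageI)
qed

text \<open>The hybrids \<open>h D\<close> follow \<open>g\<close> on \<open>D\<close> and
  \<open>f\<close> elsewhere. All of them stay inside the union of the two images of a simplex, so
  neighbouring hybrids are contiguous. A cycle has finitely many vertices, so a finite
  \<open>D\<close> reaches \<open>g\<close> even in an infinite complex.\<close>

lemma push_contiguous:
  assumes T: "abstract_complex T" and fg: "\<And>\<sigma>. \<sigma> \<in> S \<Longrightarrow> f ` \<sigma> \<union> g ` \<sigma> \<in> T"
    and c: "c \<in> cycles S n"
  shows "(\<lambda>w. push g c w - push f c w) \<in> boundaries T n"
proof -
  define h where "h D x = (if x \<in> D then g x else f x)" for D x
  have chain: "c \<in> chains S n"
    using c by (simp add: cycles_def)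
  obtain V where V: "supported V c"
    using chains_supported[OF chain] .
  have "(\<lambda>w. push (h D) c w - push f c w) \<in> boundaries T n" if "finite D" for D
    using that
  proof induction
    case empty
    have "h {} = f"
      by (simp add: h_def fun_eq_iff)
    then show ?case
      by (simp add: function_subspace_zero function_subspace_boundaries)
  next
    case (insert v D)
    have sub: "h D ` \<sigma> \<union> h (insert v D) ` \<sigma> \<in> T" if "\<sigma> \<in> S" for \<sigma>
    proof -
      have "f ` \<sigma> \<union> g ` \<sigma> \<in> T"
        using that by (rule fg)
      moreover have "h D ` \<sigma> \<union> h (insert v D) ` \<sigma> \<subseteq> f ` \<sigma> \<union> g ` \<sigma>"
        by (auto simp: h_def)
      moreover have "\<sigma> \<noteq> {}"
        using T \<open>f ` \<sigma> \<union> g ` \<sigma> \<in> T\<close> by (auto simp: abstract_complex_def)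
      ultimately show ?thesis
        using T unfolding abstract_complex_def by (metis Un_empty image_is_empty)
    qed
    have "(\<lambda>w. push (h (insert v D)) c w - push (h D) c w) \<in> boundaries T n"
      using T sub _ c by (rule push_change_vertex[where v = v]) (auto simp: h_def)
    then have "(\<lambda>w. (push (h D) c w - push f c w) + (push (h (insert v D)) c w - push (h D) c w))
        \<in> boundaries T n"
      by (rule function_subspace_add[OF function_subspace_boundaries insert.IH])
    then show ?case
      by simp
  qed
  moreover have "push (h V) c = push g c"
  proof
    fix w
    have "map (h V) xs = map g xs" if "set xs \<subseteq> V" for xs
      using that by (auto simp: h_def)
    then have "push_on V (h V) c w = push_on V g c w"
      unfolding push_on_eq_sum by (intro sum.cong) auto
    then show "push (h V) c w = push g c w"
      using push_eq_push_on[OF chains_alternating[OF chain] V] by metis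
  qed
  ultimately show ?thesis
    using V by (metis supported_def)
qed


section \<open>Quotient vector spaces\<close>

text \<open>The image of a coset may be only part of a coset (scaling by 0 collapses it to a point);
  adding \<open>W'\<close> completes it. This serves both for scalar multiplication on a quotient
  and for induced maps on homology.\<close>

lemma coset_image:
  assumes W': "abelian_subgroup W' V'" and W: "W \<subseteq> carrier V" "\<zero>\<^bsub>V\<^esub> \<in> W" "L ` W \<subseteq> W'"
    and L: "\<And>x. x \<in> carrier V \<Longrightarrow> L x \<in> carrier V'"
      "\<And>x y. x \<in> carrier V \<Longrightarrow> y \<in> carrier V \<Longrightarrow> L (x \<oplus>\<^bsub>V\<^esub> y) = L x \<oplus>\<^bsub>V'\<^esub> L y"
    and x: "x \<in> carrier V" and V: "abelian_monoid V"
  shows "W' <+>\<^bsub>V'\<^esub> (L ` (W +>\<^bsub>V\<^esub> x)) = W' +>\<^bsub>V'\<^esub> L x"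
proof
  interpret W': abelian_subgroup W' V'
    by (rule W')
  interpret V: abelian_monoid V
    by (rule V)
  have L_coset: "u \<oplus>\<^bsub>V'\<^esub> L (w \<oplus>\<^bsub>V\<^esub> x) = (u \<oplus>\<^bsub>V'\<^esub> L w) \<oplus>\<^bsub>V'\<^esub> L x" if "u \<in> W'" "w \<in> W" for u w
    using that L W x W'.a_Hcarr by (simp add: W'.a_assoc subset_eq)
  show "W' <+>\<^bsub>V'\<^esub> (L ` (W +>\<^bsub>V\<^esub> x)) \<subseteq> W' +>\<^bsub>V'\<^esub> L x"
    using L_coset W(3) by (force simp: set_add_def' a_r_coset_def')
  show "W' +>\<^bsub>V'\<^esub> L x \<subseteq> W' <+>\<^bsub>V'\<^esub> (L ` (W +>\<^bsub>V\<^esub> x))"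
  proof
    fix y
    assume "y \<in> W' +>\<^bsub>V'\<^esub> L x"
    then obtain u where "u \<in> W'" "y = u \<oplus>\<^bsub>V'\<^esub> L x"
      by (auto simp: a_r_coset_def')
    then have "u \<in> W'" "y = u \<oplus>\<^bsub>V'\<^esub> L (\<zero>\<^bsub>V\<^esub> \<oplus>\<^bsub>V\<^esub> x)"
      using x by auto
    then show "y \<in> W' <+>\<^bsub>V'\<^esub> (L ` (W +>\<^bsub>V\<^esub> x))"
      using W(2) by (auto simp: set_add_def' a_r_coset_def')
  qed
qed

locale linear_quotient = vectorspace K V
  for K :: "('k, 'm) ring_scheme" and V :: "('k, 'v) module" +
  fixes W :: "'v set"
  assumes sub: "W \<subseteq> carrier V" "\<zero>\<^bsub>V\<^esub> \<in> W"
    and sub_add: "\<And>x y. x \<in> W \<Longrightarrow> y \<in> W \<Longrightarrow> x \<oplus>\<^bsub>V\<^esub> y \<in> W"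
    and sub_smult: "\<And>a x. a \<in> carrier K \<Longrightarrow> x \<in> W \<Longrightarrow> a \<odot>\<^bsub>V\<^esub> x \<in> W"
begin

lemma abelian_subgroup_W: "abelian_subgroup W V"
proof (rule abelian_subgroupI3)
  show "additive_subgroup W V"
  proof (rule additive_subgroupI, rule M.add.subgroupI)
    show "W \<subseteq> carrier V" "W \<noteq> {}"
      using sub by auto
    show "\<ominus>\<^bsub>V\<^esub> x \<in> W" if "x \<in> W" for x
      using sub_smult[of "\<ominus>\<^bsub>K\<^esub> \<one>\<^bsub>K\<^esub>" x] that sub(1) smult_minus_1[of x] by auto
    show "x \<oplus>\<^bsub>V\<^esub> y \<in> W" if "x \<in> W" "y \<in> W" for x y
      using that by (rule sub_add)
  qed
  show "abelian_group V"
    by (rule M.abelian_group_axioms)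
qed

sublocale W: abelian_subgroup W V
  by (rule abelian_subgroup_W)

abbreviation Q :: "('k, 'v set) module" where
  "Q \<equiv> quotient_space V W"

lemma quotient_carrier: "carrier Q = (\<lambda>x. W +>\<^bsub>V\<^esub> x) ` carrier V"
  by (auto simp: quotient_space_def A_RCOSETS_def')

lemma quotient_zero: "\<zero>\<^bsub>Q\<^esub> = W +>\<^bsub>V\<^esub> \<zero>\<^bsub>V\<^esub>"
  using sub by (simp add: quotient_space_def M.a_coset_add_zero)

lemma quotient_add:
  "x \<in> carrier V \<Longrightarrow> y \<in> carrier V \<Longrightarrow> (W +>\<^bsub>V\<^esub> x) \<oplus>\<^bsub>Q\<^esub> (W +>\<^bsub>V\<^esub> y) = W +>\<^bsub>V\<^esub> (x \<oplus>\<^bsub>V\<^esub> y)"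
  by (simp add: quotient_space_def W.a_rcos_sum)

lemma quotient_smult:
  assumes "a \<in> carrier K" "x \<in> carrier V"
  shows "a \<odot>\<^bsub>Q\<^esub> (W +>\<^bsub>V\<^esub> x) = W +>\<^bsub>V\<^esub> (a \<odot>\<^bsub>V\<^esub> x)"
proof -
  have "W <+>\<^bsub>V\<^esub> ((\<lambda>x. a \<odot>\<^bsub>V\<^esub> x) ` (W +>\<^bsub>V\<^esub> x)) = W +>\<^bsub>V\<^esub> (a \<odot>\<^bsub>V\<^esub> x)"
    using assms sub sub_smult
    by (intro coset_image abelian_subgroup_W M.abelian_monoid_axioms) (auto simp: smult_r_distr)
  then show ?thesis
    by (simp add: quotient_space_def)
qed

lemma quotient_vectorspace: "vectorspace K Q"
proof (rule vectorspace.intro)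
  show "field K"
    by (rule field_axioms)
  show "module K Q"
  proof (rule moduleI)
    show "cring K"
      by (rule R.cring_axioms)
    show "abelian_group Q"
    proof (rule abelian_groupI)
      fix x
      assume "x \<in> carrier Q"
      then obtain x' where x': "x' \<in> carrier V" "x = W +>\<^bsub>V\<^esub> x'"
        by (auto simp: quotient_carrier)
      show "\<exists>y\<in>carrier Q. y \<oplus>\<^bsub>Q\<^esub> x = \<zero>\<^bsub>Q\<^esub>"
        using x' by (intro bexI[of _ "W +>\<^bsub>V\<^esub> (\<ominus>\<^bsub>V\<^esub> x')"])
          (auto simp: quotient_add quotient_zero quotient_carrier M.l_neg)
    qed (auto simp: quotient_carrier quotient_zero quotient_add M.a_ac)
  qed (auto simp: quotient_carrier quotient_smult quotient_add smult_l_distr smult_r_distr smult_assoc1)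
qed

end

section \<open>Function spaces as vector spaces\<close>

lemma function_space_simps:
  "carrier (function_space A) = A"
  "\<zero>\<^bsub>function_space A\<^esub> = (\<lambda>_. 0)"
  "f \<oplus>\<^bsub>function_space A\<^esub> g = (\<lambda>x. f x + g x)"
  "a \<odot>\<^bsub>function_space A\<^esub> f = (\<lambda>x. a * f x)"
  by (simp_all add: function_space_def)

lemma vectorspace_function_space:
  fixes A :: "('b \<Rightarrow> 'k::field) set"
  assumes "function_subspace A"
  shows "vectorspace class_ring (function_space A)"
proof (rule vectorspace.intro)
  show "field (class_ring :: 'k ring)"
    by (rule class_field.field_axioms)
  show "module (class_ring :: 'k ring) (function_space A)"
  proof (rule moduleI)
    show "cring (class_ring :: 'k ring)"
      by (rule class_cring.cring_axioms)
    show "abelian_group (function_space A)"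
    proof (rule abelian_groupI)
      fix f
      assume "f \<in> carrier (function_space A)"
      then show "\<exists>g\<in>carrier (function_space A). g \<oplus>\<^bsub>function_space A\<^esub> f = \<zero>\<^bsub>function_space A\<^esub>"
        using function_subspace_scale[OF assms, of f "- 1"]
        by (intro bexI[of _ "\<lambda>x. - 1 * f x"]) (auto simp: function_space_simps)
    qed (use assms in \<open>auto simp: function_space_simps function_subspace_zero function_subspace_add add_ac\<close>)
  qed (use assms in \<open>auto simp: function_space_simps function_subspace_scale algebra_simps\<close>)
qed

lemma linear_quotient_function_space:
  fixes A B :: "('b \<Rightarrow> 'k::field) set"
  assumes "function_subspace A" "function_subspace B" "B \<subseteq> A"
  shows "linear_quotient class_ring (function_space A) B"
  using assms by (intro linear_quotient.intro linear_quotient_axioms.intro vectorspace_function_space)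
    (auto simp: function_space_simps function_subspace_zero function_subspace_add function_subspace_scale)


section \<open>Induced maps on homology\<close>

definition homology_class :: "nat \<Rightarrow> 'a set set \<Rightarrow> ('a list \<Rightarrow> 'k::field) \<Rightarrow> ('a list \<Rightarrow> 'k) set" where
  "homology_class n S c = boundaries S n +>\<^bsub>function_space (cycles S n)\<^esub> c"

lemma linear_quotient_homology:
  assumes "abstract_complex S"
  shows "linear_quotient class_ring (function_space (cycles S n)) (boundaries S n)"
  using assms by (intro linear_quotient_function_space function_subspace_cycles
      function_subspace_boundaries boundaries_subset_cycles)

lemma homology_carrier: "carrier (homology n S) = homology_class n S ` cycles S n"
  by (auto simp: homology_def quotient_space_def A_RCOSETS_def' homology_class_def function_space_simps)

lemma vectorspace_homology:
  assumes "abstract_complex S"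
  shows "vectorspace class_ring (homology n S)"
  unfolding homology_def by (rule linear_quotient.quotient_vectorspace[OF linear_quotient_homology[OF assms]])

lemma homology_class_add:
  assumes "abstract_complex S" "b \<in> cycles S n" "c \<in> cycles S n"
  shows "homology_class n S b \<oplus>\<^bsub>homology n S\<^esub> homology_class n S c = homology_class n S (\<lambda>x. b x + c x)"
  using linear_quotient.quotient_add[OF linear_quotient_homology[OF assms(1)], of b n c] assms(2,3)
  by (simp add: homology_class_def homology_def function_space_simps)

lemma homology_class_scale:
  fixes c :: "'a list \<Rightarrow> 'k::field"
  assumes "abstract_complex S" "c \<in> cycles S n"
  shows "a \<odot>\<^bsub>homology n S\<^esub> homology_class n S c = homology_class n S (\<lambda>x. a * c x)"
  using linear_quotient.quotient_smult[OF linear_quotient_homology[OF assms(1)], of a c n] assms(2)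
  by (simp add: homology_class_def homology_def function_space_simps)

lemma homology_class_eqI:
  fixes b c :: "'a list \<Rightarrow> 'k::field"
  assumes "abstract_complex S" "b \<in> cycles S n" "(\<lambda>x. c x - b x) \<in> boundaries S n"
  shows "homology_class n S b = homology_class n S c"
proof -
  interpret linear_quotient "class_ring :: 'k ring" "function_space (cycles S n)" "boundaries S n"
    using assms(1) by (rule linear_quotient_homology)
  have "c = (\<lambda>x. (c x - b x) + b x)"
    by simp
  then have "c \<in> homology_class n S b"
    unfolding homology_class_def a_r_coset_def'
    using assms(3) by (auto simp: function_space_simps intro!: bexI[of _ "\<lambda>x. c x - b x"])
  then show ?thesis
    unfolding homology_class_def
    by (rule W.a_repr_independence') (use assms(2) in \<open>simp_all add: function_space_simps\<close>)
qed

lemma homology_map_class: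
  fixes c :: "'a list \<Rightarrow> 'k::field"
  assumes S: "abstract_complex S" and T: "abstract_complex T"
    and f: "\<And>\<sigma>. \<sigma> \<in> S \<Longrightarrow> f ` \<sigma> \<in> T" and c: "c \<in> cycles S n"
  shows "homology_map n T f (homology_class n S c) = homology_class n T (push f c)"
proof -
  interpret S: linear_quotient "class_ring :: 'k ring" "function_space (cycles S n)" "boundaries S n"
    using S by (rule linear_quotient_homology)
  interpret T: linear_quotient "class_ring :: 'k ring" "function_space (cycles T n)" "boundaries T n"
    using T by (rule linear_quotient_homology)
  show ?thesis
    unfolding homology_map_def homology_class_def
  proof (rule coset_image)
    show "abelian_subgroup (boundaries T n) (function_space (cycles T n :: ('b list \<Rightarrow> 'k) set))"
      by (rule T.abelian_subgroup_W)
    show "abelian_monoid (function_space (cycles S n :: ('a list \<Rightarrow> 'k) set))"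
      by (rule S.M.abelian_monoid_axioms)
    show "push f ` boundaries S n \<subseteq> (boundaries T n :: ('b list \<Rightarrow> 'k) set)"
      using push_in_boundaries[of S f T _ n] f by blast
    show "push f x \<in> carrier (function_space (cycles T n))"
      if "x \<in> carrier (function_space (cycles S n))" for x :: "'a list \<Rightarrow> 'k"
      using that push_in_cycles[of S f T x n] f by (simp add: function_space_simps)
    show "push f (x \<oplus>\<^bsub>function_space (cycles S n)\<^esub> y) = push f x \<oplus>\<^bsub>function_space (cycles T n)\<^esub> push f y"
      if "x \<in> carrier (function_space (cycles S n))" "y \<in> carrier (function_space (cycles S n))"
      for x y :: "'a list \<Rightarrow> 'k"
      using that push_add[of x S n y f] by (simp add: function_space_simps cycles_def)
  qed (use S.sub c in \<open>auto simp: function_space_simps\<close>)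
qed

lemma linear_map_homology_map:
  assumes S: "abstract_complex S" and T: "abstract_complex T"
    and f: "\<And>\<sigma>. \<sigma> \<in> S \<Longrightarrow> f ` \<sigma> \<in> T"
  shows "linear_map (class_ring :: 'k::field ring) (homology n S) (homology n T) (homology_map n T f)"
proof -
  have VS: "vectorspace (class_ring :: 'k ring) (homology n S)"
    and VT: "vectorspace (class_ring :: 'k ring) (homology n T)"
    using S T by (auto intro: vectorspace_homology)
  have cycle: "push f c \<in> cycles T n" if "c \<in> cycles S n" for c :: "'a list \<Rightarrow> 'k"
    using push_in_cycles[of S f T c n] f that by blast
  have add: "(\<lambda>w. b w + c w) \<in> cycles S n" if "b \<in> cycles S n" "c \<in> cycles S n" for b c :: "'a list \<Rightarrow> 'k"
    using that by (intro function_subspace_add function_subspace_cycles)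
  have scale: "(\<lambda>w. a * c w) \<in> cycles S n" if "c \<in> cycles S n" for a and c :: "'a list \<Rightarrow> 'k"
    using that by (intro function_subspace_scale function_subspace_cycles)
  have push_simps: "push f (\<lambda>w. b w + c w) = (\<lambda>w. push f b w + push f c w)"
    "push f (\<lambda>w. a * c w) = (\<lambda>w. a * push f c w)"
    if "b \<in> cycles S n" "c \<in> cycles S n" for a and b c :: "'a list \<Rightarrow> 'k"
    using that push_add[of b S n c f] push_scale[of c S n f a] by (auto simp: cycles_def)
  have "homology_map n T f \<in> module_hom (class_ring :: 'k ring) (homology n S) (homology n T)"
    by (auto simp: module_hom_def homology_carrier homology_map_class[OF S T f] cycle add scale
        homology_class_add[OF S] homology_class_scale[OF S] homology_class_add[OF T]
        homology_class_scale[OF T] push_simps)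
  then show ?thesis
    using VS VT by (intro linear_map.intro mod_hom.intro mod_hom_axioms.intro) (auto simp: vectorspace_def)
qed

lemma homology_map_comp:
  assumes "abstract_complex S" "abstract_complex T" "abstract_complex U"
    and f: "\<And>\<sigma>. \<sigma> \<in> S \<Longrightarrow> f ` \<sigma> \<in> T" and g: "\<And>\<sigma>. \<sigma> \<in> T \<Longrightarrow> g ` \<sigma> \<in> U"
    and x: "x \<in> carrier (homology n S)"
  shows "homology_map n U g (homology_map n T f x) = homology_map n U (g \<circ> f) x"
proof -
  obtain c where c: "c \<in> cycles S n" "x = homology_class n S c"
    using x by (auto simp: homology_carrier)
  have fc: "push f c \<in> cycles T n"
    using push_in_cycles[OF _ c(1)] f by blast
  have gf: "(g \<circ> f) ` \<sigma> \<in> U" if "\<sigma> \<in> S" for \<sigma>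
    using f g that by (metis image_comp)
  have "homology_map n U g (homology_map n T f x) = homology_class n U (push g (push f c))"
    using homology_map_class[OF assms(1,2) f c(1)] homology_map_class[OF assms(2,3) g fc] c(2) by simp
  also have "push g (push f c) = push (g \<circ> f) c"
    using c(1) by (intro push_push[of c S n]) (simp add: cycles_def)
  finally show ?thesis
    using homology_map_class[OF assms(1,3) gf c(1)] c(2) by simp
qed

lemma homology_map_contiguous:
  assumes S: "abstract_complex S" and T: "abstract_complex T"
    and fg: "\<And>\<sigma>. \<sigma> \<in> S \<Longrightarrow> f ` \<sigma> \<union> g ` \<sigma> \<in> T" and x: "x \<in> carrier (homology n S)"
  shows "homology_map n T f x = homology_map n T g x"
proof -
  obtain c where c: "c \<in> cycles S n" "x = homology_class n S c"
    using x by (auto simp: homology_carrier)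
  \<comment> \<open>Each image is a nonempty face of the union, so contiguity already makes both
    maps simplicial.\<close>
  have f: "f ` \<sigma> \<in> T" and g: "g ` \<sigma> \<in> T" if "\<sigma> \<in> S" for \<sigma>
    using T fg[OF that] S that unfolding abstract_complex_def
    by (metis image_is_empty Un_upper1 Un_upper2)+
  have "(\<lambda>w. push g c w - push f c w) \<in> boundaries T n"
    using T fg c(1) by (rule push_contiguous)
  then have "homology_class n T (push f c) = homology_class n T (push g c)"
    using T push_in_cycles[OF _ c(1)] f g by (intro homology_class_eqI) auto
  then show ?thesis
    using homology_map_class[OF S T f c(1)] homology_map_class[OF S T g c(1)] c(2) by simp
qed

lemma homology_map_ident:
  assumes S: "abstract_complex S" and x: "x \<in> carrier (homology n S)"
  shows "homology_map n S (\<lambda>x. x) x = x"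
proof -
  obtain c where c: "c \<in> cycles S n" "x = homology_class n S c"
    using x by (auto simp: homology_carrier)
  then have "push (\<lambda>x. x) c = c"
    by (intro push_ident[of c S n]) (simp add: cycles_def)
  then show ?thesis
    using homology_map_class[OF S S _ c(1), of "\<lambda>x. x"] c(2) by simp
qed

text \<open>Maps that agree on the vertices of simplices are contiguous. This is the right notion of
  equality here, since \<open>block_of\<close> and \<open>block_map\<close> carry no information off
  their intended domains.\<close>

lemma homology_map_cong:
  assumes S: "abstract_complex S" and T: "abstract_complex T"
    and f: "\<And>\<sigma>. \<sigma> \<in> S \<Longrightarrow> f ` \<sigma> \<in> T" and eq: "\<And>\<sigma> v. \<sigma> \<in> S \<Longrightarrow> v \<in> \<sigma> \<Longrightarrow> f v = g v"
    and x: "x \<in> carrier (homology n S)"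
  shows "homology_map n T f x = homology_map n T g x"
proof (rule homology_map_contiguous[OF S T _ x])
  show "f ` \<sigma> \<union> g ` \<sigma> \<in> T" if "\<sigma> \<in> S" for \<sigma>
  proof -
    have "g ` \<sigma> = f ` \<sigma>"
      using eq[OF that] by (metis image_cong)
    then show ?thesis
      using f[OF that] by simp
  qed
qed

lemma is_persistence_module_persistent_homology:
  assumes S: "\<And>r. 0 \<le> r \<Longrightarrow> abstract_complex (S r)"
    and f: "\<And>r s \<sigma>. 0 \<le> r \<Longrightarrow> r \<le> s \<Longrightarrow> \<sigma> \<in> S r \<Longrightarrow> f r s ` \<sigma> \<in> S s"
    and ident: "\<And>r \<sigma> v. 0 \<le> r \<Longrightarrow> \<sigma> \<in> S r \<Longrightarrow> v \<in> \<sigma> \<Longrightarrow> f r r v = v"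
    and comp: "\<And>r s t \<sigma> v. 0 \<le> r \<Longrightarrow> r \<le> s \<Longrightarrow> s \<le> t \<Longrightarrow> \<sigma> \<in> S r \<Longrightarrow> v \<in> \<sigma> \<Longrightarrow>
      f s t (f r s v) = f r t v"
  shows "is_persistence_module (class_ring :: 'k::field ring) (persistent_homology n S f)"
  unfolding is_persistence_module_def persistent_homology_def persistence_module.simps
proof (intro conjI allI impI ballI)
  show "vectorspace (class_ring :: 'k ring) (homology n (S r))" if "0 \<le> r" for r
    using that by (intro vectorspace_homology S)
  show "linear_map (class_ring :: 'k ring) (homology n (S r)) (homology n (S s)) (homology_map n (S s) (f r s))"
    if "0 \<le> r \<and> r \<le> s" for r s
    using that by (intro linear_map_homology_map S f) auto
  show "homology_map n (S r) (f r r) x = x" if "0 \<le> r" "x \<in> carrier (homology n (S r))"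
    for r and x :: "('a list \<Rightarrow> 'k) set"
  proof -
    have "homology_map n (S r) (f r r) x = homology_map n (S r) (\<lambda>x. x) x"
      using that by (intro homology_map_cong[OF S S _ ident]) (auto intro: f)
    then show ?thesis
      using that by (simp add: homology_map_ident S)
  qed
  show "homology_map n (S t) (f s t) (homology_map n (S s) (f r s) x) = homology_map n (S t) (f r t) x"
    if "0 \<le> r \<and> r \<le> s \<and> s \<le> t" "x \<in> carrier (homology n (S r))"
    for r s t and x :: "('a list \<Rightarrow> 'k) set"
  proof -
    have le: "0 \<le> r" "0 \<le> s" "0 \<le> t" "r \<le> s" "s \<le> t" "r \<le> t"
      using that(1) by auto
    have "homology_map n (S t) (f s t) (homology_map n (S s) (f r s) x) =
        homology_map n (S t) (f s t \<circ> f r s) x"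
      using le that(2) by (intro homology_map_comp[of "S r"] S f)
    also have "\<dots> = homology_map n (S t) (f r t) x"
      using le that(2)
      by (intro homology_map_cong[of "S r", symmetric]) (auto simp: comp intro: S f)
    finally show ?thesis .
  qed
qed


section \<open>Clique complexes of a metric space and of its quotients\<close>

text \<open>Zorn's lemma, as the space may be infinite: any two points in the union of a chain of
  cliques lie in a common member, so the union is a clique.\<close>

lemma clique_subset_maximal_clique:
  assumes "clique Y \<delta> r M"
  shows "\<exists>N. maximal_clique Y \<delta> r N \<and> M \<subseteq> N"
proof -
  let ?A = "{N. clique Y \<delta> r N \<and> M \<subseteq> N}"
  have "\<exists>N\<in>?A. \<forall>N'\<in>?A. N \<subseteq> N' \<longrightarrow> N' = N"
  proof (rule subset_Zorn_nonempty)
    show "?A \<noteq> {}"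
      using assms by blast
  next
    fix \<C>
    assume \<C>: "\<C> \<noteq> {}" "subset.chain ?A \<C>"
    then have sub: "\<C> \<subseteq> ?A" and total: "A \<subseteq> B \<or> B \<subseteq> A" if "A \<in> \<C>" "B \<in> \<C>" for A B
      using that by (auto simp: subset_chain_def)
    have "\<delta> x y \<le> r" if xy: "x \<in> \<Union>\<C>" "y \<in> \<Union>\<C>" for x y
    proof -
      obtain A B where AB: "A \<in> \<C>" "x \<in> A" "B \<in> \<C>" "y \<in> B"
        using xy by blast
      then obtain N where "N \<in> \<C>" "x \<in> N" "y \<in> N"
        using total[of A B] by blast
      then show ?thesis
        using \<C>(2) by (auto simp: subset_chain_def clique_def)
    qed
    then show "\<Union>\<C> \<in> ?A"
      using \<C> by (fastforce simp: subset_chain_def clique_def)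
  qed
  then obtain N where "clique Y \<delta> r N" "M \<subseteq> N" "\<And>N'. clique Y \<delta> r N' \<Longrightarrow> N \<subseteq> N' \<Longrightarrow> N' = N"
    by auto
  then show ?thesis
    unfolding maximal_clique_def by blast
qed

text \<open>This is the Vietoris-Rips complex; from here on maximal cliques are replaced by pairwise
  distance bounds.\<close>

lemma co_nerve_maximal_clique_cover:
  "co_nerve Y (maximal_clique_cover Y \<delta> r) = {\<sigma>. finite \<sigma> \<and> \<sigma> \<noteq> {} \<and> clique Y \<delta> r \<sigma>}"
proof -
  have "clique Y \<delta> r \<sigma> \<longleftrightarrow> \<sigma> \<subseteq> Y \<and> (\<exists>N. maximal_clique Y \<delta> r N \<and> \<sigma> \<subseteq> N)" for \<sigma>
  proof
    assume \<sigma>: "clique Y \<delta> r \<sigma>"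
    then show "\<sigma> \<subseteq> Y \<and> (\<exists>N. maximal_clique Y \<delta> r N \<and> \<sigma> \<subseteq> N)"
      using clique_subset_maximal_clique[OF \<sigma>] by (simp add: clique_def)
  next
    assume "\<sigma> \<subseteq> Y \<and> (\<exists>N. maximal_clique Y \<delta> r N \<and> \<sigma> \<subseteq> N)"
    then obtain N where "clique Y \<delta> r N" "\<sigma> \<subseteq> N"
      by (auto simp: maximal_clique_def)
    then show "clique Y \<delta> r \<sigma>"
      unfolding clique_def by blast
  qed
  then show ?thesis
    by (auto simp: co_nerve_def maximal_clique_cover_def)
qed

locale clique_partitioned_space = Metric_space X d for X :: "'a set" and d +
  fixes P :: "real \<Rightarrow> 'a set set"
  assumes partition: "persistent_clique_partition X d P"
begin

definition rips :: "real \<Rightarrow> 'a set set" where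
  "rips r = {\<sigma>. finite \<sigma> \<and> \<sigma> \<noteq> {} \<and> clique X d r \<sigma>}"

definition quotient_rips :: "real \<Rightarrow> 'a set set set" where
  "quotient_rips r = {\<sigma>. finite \<sigma> \<and> \<sigma> \<noteq> {} \<and> clique (P r) (block_dist d) r \<sigma>}"

definition block_of :: "real \<Rightarrow> 'a \<Rightarrow> 'a set" where
  "block_of r x = (THE C. C \<in> P r \<and> x \<in> C)"

text \<open>The choice depends on the block alone, not on the scale. A block and a larger block
  around it may still receive different points, hence naturality only up to contiguity.\<close>

definition point_of :: "'a set \<Rightarrow> 'a" where
  "point_of C = (SOME x. x \<in> C)"

section \<open>Blocks and distances between them\<close>

lemma partition_on_P: "0 \<le> r \<Longrightarrow> partition_on X (P r)"
  using partition by (simp add: persistent_clique_partition_def)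

lemma block_subset: "0 \<le> r \<Longrightarrow> C \<in> P r \<Longrightarrow> C \<subseteq> X"
  using partition_on_P[of r] by (auto simp: partition_on_def)

lemma block_unique: "0 \<le> r \<Longrightarrow> C \<in> P r \<Longrightarrow> D \<in> P r \<Longrightarrow> x \<in> C \<Longrightarrow> x \<in> D \<Longrightarrow> C = D"
  using partition_on_P[of r] by (auto simp: partition_on_def disjoint_def)

lemma block_of_eq: "0 \<le> r \<Longrightarrow> C \<in> P r \<Longrightarrow> x \<in> C \<Longrightarrow> block_of r x = C"
  unfolding block_of_def using block_unique by (intro the_equality) auto

lemma block_of:
  assumes "0 \<le> r" "x \<in> X"
  shows "block_of r x \<in> P r" "x \<in> block_of r x"
proof -
  obtain C where "C \<in> P r" "x \<in> C"
    using partition_on_P[OF assms(1)] assms(2) by (auto simp: partition_on_def)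
  then show "block_of r x \<in> P r" "x \<in> block_of r x"
    using block_of_eq[OF assms(1)] by auto
qed

lemma point_of: "0 \<le> r \<Longrightarrow> C \<in> P r \<Longrightarrow> point_of C \<in> C"
  using partition_on_P[of r] unfolding point_of_def partition_on_def by (metis some_in_eq)

lemma block_map:
  assumes "0 \<le> r" "r \<le> s" "C \<in> P r"
  shows "block_map P r s C \<in> P s" "C \<subseteq> block_map P r s C"
proof -
  obtain D where D: "D \<in> P s" "C \<subseteq> D"
    using partition assms unfolding persistent_clique_partition_def by blast
  have "block_map P r s C = D"
    unfolding block_map_def
  proof (rule the_equality)
    show "D' = D" if "D' \<in> P s \<and> C \<subseteq> D'" for D'
      using that D point_of[OF assms(1,3)] block_unique[of s D' D] assms(1,2) by auto
  qed (use D in simp)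
  with D show "block_map P r s C \<in> P s" "C \<subseteq> block_map P r s C"
    by auto
qed

text \<open>Any point of a block identifies the larger block around it. Functoriality of
  \<open>block_map\<close> and the exact identities with \<open>block_of\<close> reduce to following
  one point.\<close>

lemma block_map_eq_block_of:
  assumes "0 \<le> r" "r \<le> s" "C \<in> P r" "x \<in> C"
  shows "block_map P r s C = block_of s x"
  using block_map[OF assms(1-3)] block_of_eq[of s _ x] assms by auto

lemma block_diameter:
  assumes "0 \<le> r" "C \<in> P r" "x \<in> C" "y \<in> C"
  shows "d x y \<le> r"
proof -
  have "ereal (d x y) \<le> ediameter d C"
    unfolding ediameter_def using assms by (intro SUP_upper2[of "(x, y)"]) auto
  also have "\<dots> \<le> ereal r"
    using partition assms by (simp add: persistent_clique_partition_def)
  finally show ?thesis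
    by simp
qed

lemma block_dist_le: "x \<in> C \<Longrightarrow> y \<in> D \<Longrightarrow> block_dist d C D \<le> d x y"
  unfolding block_dist_def by (rule cINF_lower2[where x = "(x, y)"]) (auto intro: bdd_belowI2[where m = 0])

lemma block_dist_mono:
  assumes "C \<noteq> {}" "D \<noteq> {}" "C \<subseteq> C'" "D \<subseteq> D'"
  shows "block_dist d C' D' \<le> block_dist d C D"
  unfolding block_dist_def using assms by (intro cINF_superset_mono) (auto intro: bdd_belowI2[where m = 0])

text \<open>Go from \<open>x\<close> to \<open>u\<close> inside \<open>C\<close>, across to
  \<open>v\<close>, and to \<open>y\<close> inside \<open>D\<close>. The infimum may not be
  attained, so \<open>u\<close> and \<open>v\<close> are optimal only up to
  \<open>e\<close>.\<close>

lemma dist_le_block_dist: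
  assumes r: "0 \<le> r" and CD: "C \<in> P r" "D \<in> P r" and xy: "x \<in> C" "y \<in> D"
  shows "d x y \<le> 2 * r + block_dist d C D"
proof (rule field_le_epsilon)
  fix e :: real
  assume "e > 0"
  then have "(INF (u, v)\<in>C \<times> D. d u v) < block_dist d C D + e"
    by (simp add: block_dist_def)
  then obtain u v where uv: "u \<in> C" "v \<in> D" "d u v < block_dist d C D + e"
    using xy by (subst (asm) cINF_less_iff) (auto intro: bdd_belowI2[where m = 0])
  have X: "x \<in> X" "y \<in> X" "u \<in> X" "v \<in> X"
    using block_subset[OF r] CD xy uv by auto
  have "d x y \<le> d x u + (d u v + d v y)"
    using triangle[of x u y] triangle[of u v y] X by simp
  moreover have "d x u \<le> r" "d v y \<le> r"
    using block_diameter[OF r] CD xy uv by auto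
  ultimately show "d x y \<le> 2 * r + block_dist d C D + e"
    using uv(3) by simp
qed

section \<open>Rips complexes and the simplicial maps between them\<close>

lemma rips_subset:
  assumes "\<sigma> \<in> rips r" "\<tau> \<subseteq> \<sigma>" "\<tau> \<noteq> {}"
  shows "\<tau> \<in> rips r"
proof -
  have "finite \<tau>"
    using assms finite_subset by (auto simp: rips_def)
  moreover have "clique X d r \<tau>"
    using assms unfolding rips_def clique_def by blast
  ultimately show ?thesis
    using assms(3) by (simp add: rips_def)
qed

lemma abstract_complex_rips: "abstract_complex (rips r)"
  unfolding abstract_complex_def
proof (intro ballI conjI allI impI)
  show "\<sigma> \<noteq> {}" if "\<sigma> \<in> rips r" for \<sigma>
    using that by (simp add: rips_def)
qed (auto intro: rips_subset)

lemma abstract_complex_quotient_rips: "abstract_complex (quotient_rips r)"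
  unfolding abstract_complex_def quotient_rips_def clique_def by (auto intro: finite_subset)

lemma rips_mono: "\<sigma> \<in> rips r \<Longrightarrow> r \<le> s \<Longrightarrow> \<sigma> \<in> rips s"
  unfolding rips_def clique_def by force

lemma rips_vertex: "\<sigma> \<in> rips r \<Longrightarrow> x \<in> \<sigma> \<Longrightarrow> x \<in> X"
  by (auto simp: rips_def clique_def)

lemma rips_edge: "\<sigma> \<in> rips r \<Longrightarrow> x \<in> \<sigma> \<Longrightarrow> y \<in> \<sigma> \<Longrightarrow> d x y \<le> r"
  by (auto simp: rips_def clique_def)

lemma quotient_rips_vertex: "\<sigma> \<in> quotient_rips r \<Longrightarrow> C \<in> \<sigma> \<Longrightarrow> C \<in> P r"
  by (auto simp: quotient_rips_def clique_def)

lemma quotient_rips_edge: "\<sigma> \<in> quotient_rips r \<Longrightarrow> C \<in> \<sigma> \<Longrightarrow> D \<in> \<sigma> \<Longrightarrow> block_dist d C D \<le> r"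
  by (auto simp: quotient_rips_def clique_def)

lemma block_map_simplicial:
  assumes "0 \<le> r" "r \<le> s" and \<sigma>: "\<sigma> \<in> quotient_rips r"
  shows "block_map P r s ` \<sigma> \<in> quotient_rips s"
proof -
  have "block_dist d (block_map P r s C) (block_map P r s D) \<le> s" if CD: "C \<in> \<sigma>" "D \<in> \<sigma>" for C D
  proof -
    have P: "C \<in> P r" "D \<in> P r"
      using CD quotient_rips_vertex[OF \<sigma>] by auto
    then have "block_dist d (block_map P r s C) (block_map P r s D) \<le> block_dist d C D"
      using point_of[OF assms(1)] block_map[OF assms(1,2)] by (intro block_dist_mono) blast+
    then show ?thesis
      using quotient_rips_edge[OF \<sigma> CD] assms(2) by simp
  qed
  then show ?thesis
    using \<sigma> block_map(1)[OF assms(1,2)] by (auto simp: quotient_rips_def clique_def)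
qed

text \<open>Points are themselves witnesses for the distance of their blocks, so the estimate gives
  \<open>r\<close>; the scale \<open>3 * r\<close> is taken to match the shift in the other
  direction.\<close>

lemma block_of_simplicial:
  assumes "0 \<le> r" and \<sigma>: "\<sigma> \<in> rips r"
  shows "block_of (3 * r) ` \<sigma> \<in> quotient_rips (3 * r)"
proof -
  have "block_dist d (block_of (3 * r) x) (block_of (3 * r) y) \<le> 3 * r" if xy: "x \<in> \<sigma>" "y \<in> \<sigma>" for x y
  proof -
    have "block_dist d (block_of (3 * r) x) (block_of (3 * r) y) \<le> d x y"
      using xy rips_vertex[OF \<sigma>] assms(1) by (intro block_dist_le block_of) auto
    then show ?thesis
      using rips_edge[OF \<sigma> xy] assms(1) by simp
  qed
  then show ?thesis
    using \<sigma> block_of(1)[of "3 * r"] assms(1) by (auto simp: quotient_rips_def rips_def clique_def)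
qed

text \<open>
  Points of blocks that are joined by an edge at some scale \<open>r \<le> s\<close> are at distance at most
  \<open>s + r + s \<le> 3 s\<close>.  Taking \<open>s = r\<close>, this also shows that \<open>point_of\<close> is simplicial.
\<close>

lemma point_of_contiguous:
  assumes r: "0 \<le> r" "r \<le> s" and \<sigma>: "\<sigma> \<in> quotient_rips r"
  shows "(point_of \<circ> block_map P r s) ` \<sigma> \<union> point_of ` \<sigma> \<in> rips (3 * s)"
proof -
  let ?\<pi> = "block_map P r s"
  \<comment> \<open>Since \<open>C\<close> lies in its image block, the chosen points of both are in
    one block at scale \<open>s\<close>, and all comparisons can be made there.\<close>
  have in_block: "\<exists>C\<in>\<sigma>. x \<in> ?\<pi> C" if "x \<in> (point_of \<circ> ?\<pi>) ` \<sigma> \<union> point_of ` \<sigma>" for x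
    using that quotient_rips_vertex[OF \<sigma>] point_of[OF r(1)] point_of[of s] block_map[OF r] r by fastforce
  have "d x y \<le> 3 * s" if CD: "C \<in> \<sigma>" "D \<in> \<sigma>" "x \<in> ?\<pi> C" "y \<in> ?\<pi> D" for x y C D
  proof -
    have "?\<pi> C \<in> P s" "?\<pi> D \<in> P s"
      using CD quotient_rips_vertex[OF \<sigma>] block_map[OF r] by auto
    then have "d x y \<le> 2 * s + block_dist d (?\<pi> C) (?\<pi> D)"
      using CD r by (intro dist_le_block_dist) auto
    moreover have "block_dist d (?\<pi> C) (?\<pi> D) \<le> s"
      using quotient_rips_edge[OF block_map_simplicial[OF r \<sigma>]] CD by auto
    ultimately show ?thesis
      by simp
  qed
  moreover have "x \<in> X" if "C \<in> \<sigma>" "x \<in> ?\<pi> C" for x C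
    using that quotient_rips_vertex[OF \<sigma>] block_map[OF r] block_subset[of s] r by fastforce
  ultimately have "clique X d (3 * s) ((point_of \<circ> ?\<pi>) ` \<sigma> \<union> point_of ` \<sigma>)"
    unfolding clique_def using in_block by (meson subsetI)
  then show ?thesis
    using \<sigma> by (simp add: rips_def quotient_rips_def)
qed

lemma point_of_simplicial:
  assumes "0 \<le> r" and "\<sigma> \<in> quotient_rips r"
  shows "point_of ` \<sigma> \<in> rips (3 * r)"
proof -
  have "(point_of \<circ> block_map P r r) ` \<sigma> \<union> point_of ` \<sigma> \<in> rips (3 * r)"
    using assms by (intro point_of_contiguous) auto
  moreover have "point_of ` \<sigma> \<noteq> {}"
    using assms(2) by (auto simp: quotient_rips_def)
  ultimately show ?thesis
    using rips_subset[OF _ Un_upper2] by metis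
qed

text \<open>A point and the chosen point of its block share a block at scale \<open>3 * r\<close>.
  The general estimate at that scale, \<open>2 * (3 * r) + 3 * r\<close>, is exactly the scale of
  the double shift.\<close>

lemma point_of_block_of_contiguous:
  assumes r: "0 \<le> r" and \<sigma>: "\<sigma> \<in> rips r"
  shows "(point_of \<circ> block_of (3 * r)) ` \<sigma> \<union> (\<lambda>x. x) ` \<sigma> \<in> rips (3 * (3 * r))"
proof -
  let ?\<beta> = "block_of (3 * r)"
  have r3: "0 \<le> 3 * r"
    using r by simp
  have \<beta>: "?\<beta> x \<in> P (3 * r)" "x \<in> ?\<beta> x" if "x \<in> \<sigma>" for x
    using block_of[OF r3] rips_vertex[OF \<sigma> that] by auto
  have in_block: "\<exists>x\<in>\<sigma>. u \<in> ?\<beta> x" if "u \<in> (point_of \<circ> ?\<beta>) ` \<sigma> \<union> (\<lambda>x. x) ` \<sigma>" for u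
    using that \<beta> point_of[OF r3] by auto
  have "d u v \<le> 3 * (3 * r)" if "x \<in> \<sigma>" "y \<in> \<sigma>" "u \<in> ?\<beta> x" "v \<in> ?\<beta> y" for u v x y
  proof -
    have "d u v \<le> 2 * (3 * r) + block_dist d (?\<beta> x) (?\<beta> y)"
      using that \<beta> by (intro dist_le_block_dist r3) auto
    moreover have "block_dist d (?\<beta> x) (?\<beta> y) \<le> 3 * r"
      using quotient_rips_edge[OF block_of_simplicial[OF r \<sigma>]] that by auto
    ultimately show ?thesis
      by simp
  qed
  moreover have "u \<in> X" if "x \<in> \<sigma>" "u \<in> ?\<beta> x" for u x
    using that \<beta> block_subset[OF r3] by blast
  ultimately have "clique X d (3 * (3 * r)) ((point_of \<circ> ?\<beta>) ` \<sigma> \<union> (\<lambda>x. x) ` \<sigma>)"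
    unfolding clique_def using in_block by (meson subsetI)
  then show ?thesis
    using \<sigma> by (simp add: rips_def)
qed

section \<open>The two persistence modules and their interleaving\<close>

lemma clique_homology_eq: "clique_homology n X d = persistent_homology n rips (\<lambda>r s x. x)"
  by (simp add: clique_homology_def co_nerve_maximal_clique_cover rips_def[abs_def])

lemma quotient_clique_homology_eq:
  "quotient_clique_homology n d P = persistent_homology n quotient_rips (block_map P)"
  by (simp add: quotient_clique_homology_def co_nerve_maximal_clique_cover quotient_rips_def[abs_def])

lemma is_persistence_module_clique_homology:
  "is_persistence_module (class_ring :: 'k::field ring) (clique_homology n X d)"
  unfolding clique_homology_eq
  by (rule is_persistence_module_persistent_homology) (auto intro: abstract_complex_rips rips_mono)

lemma is_persistence_module_quotient_clique_homology:
  "is_persistence_module (class_ring :: 'k::field ring) (quotient_clique_homology n d P)"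
  unfolding quotient_clique_homology_eq
proof (rule is_persistence_module_persistent_homology)
  show "block_map P r r C = C" if "0 \<le> r" "\<sigma> \<in> quotient_rips r" "C \<in> \<sigma>" for r \<sigma> C
    using that quotient_rips_vertex[OF that(2,3)] point_of[of r C]
    by (metis block_map_eq_block_of block_of_eq order_refl)
  show "block_map P s t (block_map P r s C) = block_map P r t C"
    if "0 \<le> r" "r \<le> s" "s \<le> t" "\<sigma> \<in> quotient_rips r" "C \<in> \<sigma>" for r s t \<sigma> C
  proof -
    have C: "C \<in> P r" "point_of C \<in> C"
      using that quotient_rips_vertex point_of by auto
    then have "block_map P s t (block_map P r s C) = block_of t (point_of C)"
      using that block_map[of r s C] by (intro block_map_eq_block_of) auto
    also have "\<dots> = block_map P r t C"
      using that C by (intro block_map_eq_block_of[symmetric]) auto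
    finally show ?thesis .
  qed
qed (auto intro: abstract_complex_quotient_rips block_map_simplicial)

lemma natural_block_of:
  "natural_transformation (class_ring :: 'k::field ring) (clique_homology n X d)
     (rescale 3 (quotient_clique_homology n d P))
     (\<lambda>r. homology_map n (quotient_rips (3 * r)) (block_of (3 * r)))"
  unfolding natural_transformation_def clique_homology_eq quotient_clique_homology_eq
    persistent_homology_def rescale_def persistence_module.simps
proof (intro conjI allI impI ballI)
  show "linear_map (class_ring :: 'k ring) (homology n (rips r)) (homology n (quotient_rips (3 * r)))
      (homology_map n (quotient_rips (3 * r)) (block_of (3 * r)))" if "0 \<le> r" for r
    using that
    by (intro linear_map_homology_map abstract_complex_rips abstract_complex_quotient_rips block_of_simplicial)
next
  fix r s :: real and x :: "('a list \<Rightarrow> 'k) set"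
  assume rs: "0 \<le> r \<and> r \<le> s" and x: "x \<in> carrier (homology n (rips r))"
  let ?h = "homology_map n (quotient_rips (3 * s))"
  have "?h (block_of (3 * s)) (homology_map n (rips s) (\<lambda>x. x) x) = ?h (block_of (3 * s) \<circ> (\<lambda>x. x)) x"
    using rs x by (intro homology_map_comp[of "rips r"] abstract_complex_rips abstract_complex_quotient_rips
        block_of_simplicial) (auto intro: rips_mono)
  also have "\<dots> = ?h (block_map P (3 * r) (3 * s) \<circ> block_of (3 * r)) x"
  proof (rule homology_map_cong[OF abstract_complex_rips abstract_complex_quotient_rips _ _ x])
    show "(block_of (3 * s) \<circ> (\<lambda>x. x)) ` \<sigma> \<in> quotient_rips (3 * s)" if "\<sigma> \<in> rips r" for \<sigma>
      using that rs block_of_simplicial[of s \<sigma>] rips_mono[of \<sigma> r s] by (simp add: comp_def)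
    show "(block_of (3 * s) \<circ> (\<lambda>x. x)) v = (block_map P (3 * r) (3 * s) \<circ> block_of (3 * r)) v"
      if "\<sigma> \<in> rips r" "v \<in> \<sigma>" for \<sigma> v
      using rs rips_vertex[OF that] block_of[of "3 * r" v]
        block_map_eq_block_of[of "3 * r" "3 * s" "block_of (3 * r) v" v] by simp
  qed
  also have "\<dots> = ?h (block_map P (3 * r) (3 * s)) (homology_map n (quotient_rips (3 * r)) (block_of (3 * r)) x)"
    using rs x by (intro homology_map_comp[of "rips r", symmetric] abstract_complex_rips
        abstract_complex_quotient_rips block_of_simplicial block_map_simplicial) auto
  finally show "?h (block_of (3 * s)) (homology_map n (rips s) (\<lambda>x. x) x) =
      ?h (block_map P (3 * r) (3 * s)) (homology_map n (quotient_rips (3 * r)) (block_of (3 * r)) x)" .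
qed

lemma natural_point_of:
  "natural_transformation (class_ring :: 'k::field ring) (quotient_clique_homology n d P)
     (rescale 3 (clique_homology n X d)) (\<lambda>r. homology_map n (rips (3 * r)) point_of)"
  unfolding natural_transformation_def clique_homology_eq quotient_clique_homology_eq
    persistent_homology_def rescale_def persistence_module.simps
proof (intro conjI allI impI ballI)
  show "linear_map (class_ring :: 'k ring) (homology n (quotient_rips r)) (homology n (rips (3 * r)))
      (homology_map n (rips (3 * r)) point_of)" if "0 \<le> r" for r
    using that
    by (intro linear_map_homology_map abstract_complex_rips abstract_complex_quotient_rips point_of_simplicial)
next
  fix r s :: real and x :: "('a set list \<Rightarrow> 'k) set"
  assume rs: "0 \<le> r \<and> r \<le> s" and x: "x \<in> carrier (homology n (quotient_rips r))"
  let ?h = "homology_map n (rips (3 * s))"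
  have "?h point_of (homology_map n (quotient_rips s) (block_map P r s) x) = ?h (point_of \<circ> block_map P r s) x"
    using rs x by (intro homology_map_comp[of "quotient_rips r"] abstract_complex_rips
        abstract_complex_quotient_rips point_of_simplicial block_map_simplicial) auto
  also have "\<dots> = ?h point_of x"
    using rs by (intro homology_map_contiguous[OF abstract_complex_quotient_rips abstract_complex_rips _ x]
        point_of_contiguous) auto
  also have "\<dots> = ?h ((\<lambda>x. x) \<circ> point_of) x"
    by (simp add: comp_def)
  also have "\<dots> = ?h (\<lambda>x. x) (homology_map n (rips (3 * r)) point_of x)"
    using rs x by (intro homology_map_comp[of "quotient_rips r", symmetric] abstract_complex_rips
        abstract_complex_quotient_rips point_of_simplicial) (auto intro: rips_mono)
  finally show "?h point_of (homology_map n (quotient_rips s) (block_map P r s) x) =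
      ?h (\<lambda>x. x) (homology_map n (rips (3 * r)) point_of x)" .
qed

lemma point_of_after_block_of:
  assumes r: "0 \<le> r" and x: "x \<in> carrier (homology n (rips r))"
  shows "homology_map n (rips (3 * (3 * r))) point_of
      (homology_map n (quotient_rips (3 * r)) (block_of (3 * r)) x) =
    homology_map n (rips (3 * (3 * r))) (\<lambda>x. x) x"
proof -
  let ?h = "homology_map n (rips (3 * (3 * r)))"
  have "?h point_of (homology_map n (quotient_rips (3 * r)) (block_of (3 * r)) x) =
      ?h (point_of \<circ> block_of (3 * r)) x"
    using r x by (intro homology_map_comp[of "rips r"] abstract_complex_rips
        abstract_complex_quotient_rips point_of_simplicial block_of_simplicial) auto
  also have "\<dots> = ?h (\<lambda>x. x) x"
    using r by (intro homology_map_contiguous[OF abstract_complex_rips abstract_complex_rips _ x]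
        point_of_block_of_contiguous)
  finally show ?thesis .
qed

text \<open>Whichever point of a block is chosen, its block at scale \<open>3 * (3 * r)\<close> is
  the one containing the original block, so the maps agree on vertices.\<close>

lemma block_of_after_point_of:
  assumes r: "0 \<le> r" and x: "x \<in> carrier (homology n (quotient_rips r))"
  shows "homology_map n (quotient_rips (3 * (3 * r))) (block_of (3 * (3 * r)))
      (homology_map n (rips (3 * r)) point_of x) =
    homology_map n (quotient_rips (3 * (3 * r))) (block_map P r (3 * (3 * r))) x"
proof -
  let ?h = "homology_map n (quotient_rips (3 * (3 * r)))"
  have "?h (block_of (3 * (3 * r))) (homology_map n (rips (3 * r)) point_of x) =
      ?h (block_of (3 * (3 * r)) \<circ> point_of) x"
    using r x by (intro homology_map_comp[of "quotient_rips r"] abstract_complex_rips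
        abstract_complex_quotient_rips point_of_simplicial block_of_simplicial) auto
  also have "\<dots> = ?h (block_map P r (3 * (3 * r))) x"
  proof (rule homology_map_cong[OF abstract_complex_quotient_rips abstract_complex_quotient_rips _ _ x])
    show "(block_of (3 * (3 * r)) \<circ> point_of) ` \<sigma> \<in> quotient_rips (3 * (3 * r))"
      if "\<sigma> \<in> quotient_rips r" for \<sigma>
      unfolding image_comp[symmetric] using r that by (intro block_of_simplicial point_of_simplicial) auto
    show "(block_of (3 * (3 * r)) \<circ> point_of) C = block_map P r (3 * (3 * r)) C"
      if "\<sigma> \<in> quotient_rips r" "C \<in> \<sigma>" for \<sigma> C
      using r quotient_rips_vertex[OF that] point_of[OF r, of C]
        block_map_eq_block_of[of r "3 * (3 * r)" C "point_of C"] by simp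
  qed
  finally show ?thesis .
qed

lemma approximated_clique_homology:
  "approximated (class_ring :: 'k::field ring) 3 (clique_homology n X d) (quotient_clique_homology n d P)"
proof -
  have nine: "3\<^sup>2 * r = 3 * (3 * r)" for r :: real
    by simp
  let ?F = "clique_homology n X d :: ('k, ('a list \<Rightarrow> 'k) set) persistence_module"
  let ?G = "quotient_clique_homology n d P :: ('k, ('a set list \<Rightarrow> 'k) set) persistence_module"
  let ?\<phi> = "\<lambda>r. homology_map n (quotient_rips (3 * r)) (block_of (3 * r))"
  let ?\<psi> = "\<lambda>r. homology_map n (rips (3 * r)) point_of"
  have \<psi>\<phi>: "?\<psi> (3 * r) (?\<phi> r x) = map_at ?F r (3\<^sup>2 * r) x" if "0 \<le> r" "x \<in> carrier (space_at ?F r)" for r x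
    using that point_of_after_block_of unfolding nine clique_homology_eq persistent_homology_def
      persistence_module.simps by blast
  have \<phi>\<psi>: "?\<phi> (3 * r) (?\<psi> r y) = map_at ?G r (3\<^sup>2 * r) y"
    if "0 \<le> r" "y \<in> carrier (space_at ?G r)" for r y
    using that block_of_after_point_of unfolding nine quotient_clique_homology_eq persistent_homology_def
      persistence_module.simps by blast
  show ?thesis
    unfolding approximated_def
  proof (intro conjI exI[of _ ?\<phi>] exI[of _ ?\<psi>] allI impI ballI)
    show "natural_transformation class_ring ?F (rescale 3 ?G) ?\<phi>"
      by (rule natural_block_of)
    show "natural_transformation class_ring ?G (rescale 3 ?F) ?\<psi>"
      by (rule natural_point_of)
    show "is_persistence_module class_ring ?F" "is_persistence_module class_ring ?G"
      by (rule is_persistence_module_clique_homology is_persistence_module_quotient_clique_homology)+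
  qed (rule \<psi>\<phi> \<phi>\<psi> | simp)+
qed

end

theorem corollary6p4:
  fixes X :: "'a set" and d :: "'a \<Rightarrow> 'a \<Rightarrow> real" and P :: "real \<Rightarrow> 'a set set"
  assumes "Metric_space X d"
    and "persistent_clique_partition X d P"
  shows "\<forall>n. approximated (class_ring :: 'k::field ring) 3
           (clique_homology n X d) (quotient_clique_homology n d P)"
  using assms by (intro allI clique_partitioned_space.approximated_clique_homology
      clique_partitioned_space.intro clique_partitioned_space_axioms.intro)

end
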